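(* Let $k\ge1$ and $n\ge 2k+1$. For every $k$-valid $0/1$-sequence $\sigma$ of size $n-2k$, the linear functional $x\mapsto\langle\sigma,x\rangle$ attains its minimum over the beam polytope $\Omega_{n,k}$ on a facet $F_\sigma$ of $\Omega_{n,k}$, and for every $k$-triangulation $T$ of the $n$-gon, the beam vector $\psi(T)$ lies in $F_\sigma$ if and only if $T$ contains the set of edges $D(\sigma)$.
   Context: Let $V_n=\{0,\dots,n-1\}$ be the vertices of a convex $n$-gon, $E_n$ its edges $[u,v]$. Two edges cross if their endpoints are distinct and alternate cyclically; an $\ell$-crossing is a set of $\ell$ pairwise crossing edges. A $k$-triangulation is a maximal subset of $E_n$ with no $(k+1)$-crossing. A $k$-star is the set of edges $\{[s_j,s_{j+k}]: j\in\mathbb{Z}_{2k+1}\}$ for $2k+1$ vertices $s_1<\dots<s_{2k+1}$ (indices mod $2k+1$). Every $k$-triangulation $T$ is the union of exactly $n-2k$ $k$-stars, and for each $i\in\{1,\dots,n-2k\}$ exactly one of them, called the $i$-th $k$-star of $T$, has $(k+1)$-th smallest vertex equal to $k-1+i$. The beam vector $\psi(T)\in\mathbb{R}^{n-2k}$ has $i$-th coordinate $\psi(T)_i=\sum_{j=1}^k (s_{j+1}-s_j)(s_{k+1+j}-s_{k+1})$, where $s_1<\dots<s_{2k+1}$ are the vertices of the $i$-th $k$-star of $T$. The beam polytope $\Omega_{n,k}$ is the convex hull of the beam vectors of all $k$-triangulations of the $n$-gon. A $0/1$-sequence of size $q$ is $k$-valid if it is neither $(0,\dots,0)$ nor $(1,\dots,1)$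 and contains no consecutive block $1\,0^r\,1$ with $r\ge k$. For $\sigma\in\{0,1\}^{n-2k}$, let $|\sigma|_0$ be its number of zeros, index the positions of the length-$n$ sequence $0^k\sigma0^k$ by $0,\dots,n-1$, let $\zeta_i(\sigma)$ be the position of its $i$-th zero ($1\le i\le|\sigma|_0+2k$), and set $D(\sigma)=\{[\zeta_i(\sigma),\zeta_{i+k}(\sigma)]: 1\le i\le |\sigma|_0+k\}$. *)

theory Defs
  imports "HOL-Analysis.Analysis" "HOL-Library.Sublist"
begin

text \<open>The vertices of the convex \<open>n\<close>-gon are \<open>{..<n}\<close>, labelled cyclically. An edge is an unordered
  pair of distinct vertices; boundary edges of the polygon are included.\<close>

definition edges :: "nat \<Rightarrow> nat set set" where
  "edges n = {{u, v} | u v. u < n \<and> v < n \<and> u \<noteq> v}"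

definition crosses :: "nat set \<Rightarrow> nat set \<Rightarrow> bool" where
  "crosses e f \<longleftrightarrow> (\<exists>a b c d. a < b \<and> b < c \<and> c < d \<and>
     (e = {a, c} \<and> f = {b, d} \<or> e = {b, d} \<and> f = {a, c}))"

definition is_crossing :: "nat \<Rightarrow> nat \<Rightarrow> nat set set \<Rightarrow> bool" where
  "is_crossing n l X \<longleftrightarrow> X \<subseteq> edges n \<and> card X = l \<and> pairwise crosses X"

definition crossing_free :: "nat \<Rightarrow> nat \<Rightarrow> nat set set \<Rightarrow> bool" where
  "crossing_free n l T \<longleftrightarrow> \<not> (\<exists>X \<subseteq> T. is_crossing n l X)"

definition k_triangulation :: "nat \<Rightarrow> nat \<Rightarrow> nat set set \<Rightarrow> bool" where
  "k_triangulation n k T \<longleftrightarrow> T \<subseteq> edges n \<and> crossing_free n (k + 1) T \<and>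
     (\<forall>T'. T \<subset> T' \<and> T' \<subseteq> edges n \<longrightarrow> \<not> crossing_free n (k + 1) T')"

text \<open>A \<open>k\<close>-star is represented by the increasing list of its vertices, so that \<open>s ! (j - 1)\<close> is the
  \<open>j\<close>-th smallest vertex \<open>s\<^sub>j\<close>.\<close>

definition star_vertices :: "nat \<Rightarrow> nat \<Rightarrow> nat list \<Rightarrow> bool" where
  "star_vertices n k s \<longleftrightarrow> length s = 2 * k + 1 \<and> sorted_wrt (<) s \<and> set s \<subseteq> {..<n}"

definition star_edges :: "nat \<Rightarrow> nat list \<Rightarrow> nat set set" where
  "star_edges k s = {{s ! j, s ! ((j + k) mod (2 * k + 1))} | j. j < 2 * k + 1}"

text \<open>A \<open>k\<close>-triangulation of the \<open>n\<close>-gon is the union of the \<open>n - 2 * k\<close> many \<open>k\<close>-stars it contains, and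
  for \<open>1 \<le> i \<le> n - 2 * k\<close> exactly one of them has \<open>(k+1)\<close>-th smallest vertex \<open>k - 1 + i\<close>; this is what
  makes the following description definite.\<close>

definition ith_star :: "nat \<Rightarrow> nat \<Rightarrow> nat set set \<Rightarrow> nat \<Rightarrow> nat list" where
  "ith_star n k T i =
     (THE s. star_vertices n k s \<and> star_edges k s \<subseteq> T \<and> s ! k = k - 1 + i)"

definition beam_coord :: "nat \<Rightarrow> nat \<Rightarrow> nat set set \<Rightarrow> nat \<Rightarrow> real" where
  "beam_coord n k T i = (let s = ith_star n k T i in
     \<Sum>j = 1..k. (real (s ! j) - real (s ! (j - 1))) * (real (s ! (k + j)) - real (s ! k)))"

text \<open>The space of dimension \<open>n - 2 * k\<close> is \<open>real ^ 'd\<close> for a finite linearly ordered index type \<open>'d\<close>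
  of that cardinality. The order on \<open>'d\<close> only serves to number the coordinates from \<open>1\<close> to
  \<open>CARD('d)\<close>.\<close>

definition coord_no :: "'d::{finite,linorder} \<Rightarrow> nat" where
  "coord_no a = card {..a}"

definition beam_vector :: "nat \<Rightarrow> nat \<Rightarrow> nat set set \<Rightarrow> real ^ 'd::{finite,linorder}" where
  "beam_vector n k T = (\<chi> a. beam_coord n k T (coord_no a))"

definition beam_polytope :: "nat \<Rightarrow> nat \<Rightarrow> (real ^ 'd::{finite,linorder}) set" where
  "beam_polytope n k = convex hull (beam_vector n k ` {T. k_triangulation n k T})"

definition k_valid :: "nat \<Rightarrow> nat \<Rightarrow> nat list \<Rightarrow> bool" where
  "k_valid k q \<sigma> \<longleftrightarrow> length \<sigma> = q \<and> set \<sigma> \<subseteq> {0, 1} \<and>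
     \<sigma> \<noteq> replicate q 0 \<and> \<sigma> \<noteq> replicate q 1 \<and>
     \<not> (\<exists>r \<ge> k. sublist ([1] @ replicate r 0 @ [1]) \<sigma>)"

definition seq_vector :: "nat list \<Rightarrow> real ^ 'd::{finite,linorder}" where
  "seq_vector \<sigma> = (\<chi> a. real (\<sigma> ! (coord_no a - 1)))"

definition zero_pos :: "nat \<Rightarrow> nat list \<Rightarrow> nat \<Rightarrow> nat" where
  "zero_pos k \<sigma> i = (let w = replicate k 0 @ \<sigma> @ replicate k 0 in
     filter (\<lambda>p. w ! p = 0) [0..<length w] ! (i - 1))"

definition D_edges :: "nat \<Rightarrow> nat list \<Rightarrow> nat set set" where
  "D_edges k \<sigma> = {{zero_pos k \<sigma> i, zero_pos k \<sigma> (i + k)} | i. 1 \<le> i \<and> i \<le> count_list \<sigma> 0 + k}"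

definition minimizers :: "'a::real_inner \<Rightarrow> 'a set \<Rightarrow> 'a set" where
  "minimizers c P = {x \<in> P. \<forall>y \<in> P. c \<bullet> x \<le> c \<bullet> y}"

end

theory Submission imports Defs begin

text \<open>Draw the edge \<open>{x, y}\<close> with \<open>x < y\<close> as the cell in column \<open>x\<close> and row \<open>y\<close>. A crossing is then a
  chain of cells, strictly increasing in both coordinates, whose columns all lie below its rows, and
  the star with middle vertex \<open>m\<close> is a monotone staircase that enters along row \<open>m\<close>, leaves along
  column \<open>m\<close> and turns only at cells of \<open>T\<close>; its coordinate of the beam vector is the area below it.
  For a corner \<open>(X, Y)\<close> of the grid let \<open>lpp T c X Y\<close> be the length of a longest chain of cells of \<open>T\<close>
  in columns below \<open>X\<close> and rows \<open>c, ..., Y - 1\<close>. Maximality of \<open>T\<close> makes the region below the staircase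
  of \<open>m\<close> equal to the set of corners where this length drops by one as \<open>c\<close> passes from \<open>m\<close> to \<open>m + 1\<close>.
  Summing over \<open>m\<close> telescopes, so the number of staircases above a given corner does not depend on
  \<open>T\<close>. Counting only the staircases of the ones of \<open>\<sigma>\<close> gives a lower bound at each corner, and hence
  for the functional; it is attained at all corners simultaneously exactly when \<open>T\<close> contains \<open>D(\<sigma>)\<close>.

  For the dimension, the union of the edge sets \<open>D\<close> of a chain of zero sets has no \<open>(k + 1)\<close>-crossing, so
  turning the zeros into ones in any order yields a \<open>k\<close>-triangulation whose beam vector is determined by
  the minima. Transposing two consecutive steps of the order changes the beam vector by a multiple of a
  difference of two unit vectors, which is nonzero if the two vertices lie in an interval with \<open>k + 1\<close>
  zeros. Validity of \<open>\<sigma>\<close> provides such exchanges inside the facet for consecutive zeros and for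
  consecutive ones.\<close>


section \<open>Crossings as chains of cells\<close>

definition chain :: "(nat \<times> nat) list \<Rightarrow> bool" where
  "chain = sorted_wrt (\<lambda>u v. fst u < fst v \<and> snd u < snd v)"

definition cell_edge :: "nat \<times> nat \<Rightarrow> nat set" where
  "cell_edge u = {fst u, snd u}"

lemma chain_append:
  "chain (us @ vs) \<longleftrightarrow> chain us \<and> chain vs \<and>
     (\<forall>u\<in>set us. \<forall>v\<in>set vs. fst u < fst v \<and> snd u < snd v)"
  by (simp add: chain_def sorted_wrt_append)

lemma chain_Nil [simp]: "chain []"
  by (simp add: chain_def)

lemma chain_Cons:
  "chain (u # us) \<longleftrightarrow> (\<forall>v\<in>set us. fst u < fst v \<and> snd u < snd v) \<and> chain us"
  by (simp add: chain_def)

lemma chain_map_upt: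
  assumes "\<And>i j. a \<le> i \<Longrightarrow> i < j \<Longrightarrow> j < b \<Longrightarrow> fst (f i) < fst (f j) \<and> snd (f i) < snd (f j)"
  shows "chain (map f [a..<b])"
  using assms by (auto simp: chain_def sorted_wrt_map sorted_wrt_iff_nth_less)

lemma chain_take: "chain us \<Longrightarrow> chain (take i us)"
  by (metis append_take_drop_id chain_append)

lemma chain_length_le_fst:
  assumes "chain us" "\<forall>u\<in>set us. a \<le> fst u \<and> fst u < b"
  shows "length us \<le> b - a"
proof -
  have "distinct (map fst us)"
    using assms(1) unfolding chain_def
    by (induction us) (auto dest: less_imp_neq)
  then have "length us = card (fst ` set us)"
    by (metis distinct_card length_map set_map)
  also have "\<dots> \<le> card {a..<b}" using assms(2) by (intro card_mono) auto
  finally show ?thesis by simp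
qed

lemma chain_length_le_snd:
  assumes "chain us" "\<forall>u\<in>set us. a \<le> snd u \<and> snd u < b"
  shows "length us \<le> b - a"
proof -
  have "distinct (map snd us)"
    using assms(1) unfolding chain_def
    by (induction us) (auto dest: less_imp_neq)
  then have "length us = card (snd ` set us)"
    by (metis distinct_card length_map set_map)
  also have "\<dots> \<le> card {a..<b}" using assms(2) by (intro card_mono) auto
  finally show ?thesis by simp
qed

lemma crosses_Min_Max:
  assumes "crosses e f"
  shows "Min e < Min f \<and> Min f < Max e \<and> Max e < Max f \<or>
         Min f < Min e \<and> Min e < Max f \<and> Max f < Max e"
  using assms by (auto simp: crosses_def)

lemma crosses_disjoint: "crosses e f \<Longrightarrow> e \<inter> f = {}"
  by (auto simp: crosses_def)

lemma edge_Min_Max: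
  assumes "e \<in> edges n"
  shows "Min e < Max e" "Max e < n" "e = {Min e, Max e}"
proof -
  obtain u v where "e = {u, v}" "u < v" "v < n"
    using assms unfolding edges_def by (auto simp: doubleton_eq_iff) (metis insert_commute linorder_neqE_nat)
  then show "Min e < Max e" "Max e < n" "e = {Min e, Max e}" by auto
qed

text \<open>Crossing edges have distinct minima, and their maxima are ordered like their minima. So
  listing a crossing by minima makes it a chain, and all its columns lie below all its rows.\<close>

lemma crossing_imp_chain:
  assumes "X \<subseteq> edges n" "finite X" "pairwise crosses X"
  obtains us where "chain us" "cell_edge ` set us = X" "length us = card X"
    "\<And>u v. u \<in> set us \<Longrightarrow> v \<in> set us \<Longrightarrow> fst u < snd v"
proof -
  have cr: "Min e < Min f \<and> Min f < Max e \<and> Max e < Max f \<or>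
         Min f < Min e \<and> Min e < Max f \<and> Max f < Max e" if "e \<in> X" "f \<in> X" "e \<noteq> f" for e f
    using crosses_Min_Max assms(3) that unfolding pairwise_def by metis
  have inj: "inj_on Min X"
  proof (rule inj_onI)
    fix e f assume "e \<in> X" "f \<in> X" "Min e = Min f"
    then show "e = f" using cr[of e f] by auto
  qed
  define g where "g = the_inv_into X Min"
  have g: "g (Min e) = e" if "e \<in> X" for e
    unfolding g_def using the_inv_into_f_f[OF inj that] .
  define us where "us = map (\<lambda>a. (a, Max (g a))) (sorted_list_of_set (Min ` X))"
  have fin: "finite (Min ` X)" using assms(2) by simp
  have su: "set us = (\<lambda>e. (Min e, Max e)) ` X"
    unfolding us_def using fin g by (auto simp: image_iff)
  show thesis
  proof
    have "sorted_wrt (<) (sorted_list_of_set (Min ` X))" by simp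
    then show "chain us" unfolding us_def chain_def sorted_wrt_map
    proof (rule sorted_wrt_mono_rel[rotated])
      fix a b assume "a \<in> set (sorted_list_of_set (Min ` X))" "b \<in> set (sorted_list_of_set (Min ` X))"
        and ab: "a < b"
      then obtain e f where "e \<in> X" "f \<in> X" "a = Min e" "b = Min f" using fin by auto
      then show "fst (a, Max (g a)) < fst (b, Max (g b)) \<and> snd (a, Max (g a)) < snd (b, Max (g b))"
        using ab cr[of e f] g by auto
    qed
    show "cell_edge ` set us = X"
      unfolding su image_image cell_edge_def using edge_Min_Max(3) assms(1)
      by (metis (no_types, lifting) fst_conv image_cong image_ident snd_conv subsetD)
    show "length us = card X" unfolding us_def using card_image[OF inj] by simp
    fix u v assume "u \<in> set us" "v \<in> set us"
    then obtain e f where "e \<in> X" "f \<in> X" "u = (Min e, Max e)" "v = (Min f, Max f)"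
      unfolding su by auto
    then show "fst u < snd v"
      using cr[of e f] edge_Min_Max(1)[of e n] assms(1) by (cases "e = f") auto
  qed
qed

text \<open>The bound \<open>c\<close> separates the columns from the rows, so any two cells of the
  chain are crossing edges, and \<open>k + 1\<close> of them would form a forbidden
  crossing.\<close>

lemma chain_length_le:
  assumes cf: "crossing_free n (k + 1) T" and T: "T \<subseteq> edges n" and us: "chain us"
    and inT: "\<forall>u\<in>set us. cell_edge u \<in> T \<and> fst u < c \<and> c \<le> snd u"
  shows "length us \<le> k"
proof (rule ccontr)
  assume "\<not> length us \<le> k"
  define vs where "vs = take (k + 1) us"
  have lv: "length vs = k + 1" using \<open>\<not> length us \<le> k\<close> by (simp add: vs_def)
  have vs: "chain vs" "set vs \<subseteq> set us" using us chain_take by (auto simp: vs_def dest: in_set_takeD)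
  have cr: "crosses (cell_edge u) (cell_edge v)"
    if "u \<in> set vs" "v \<in> set vs" "fst u < fst v" "snd u < snd v" for u v
  proof -
    have "fst v < snd u" using that(1,2) vs(2) inT by (meson less_le_trans subsetD)
    then show ?thesis unfolding crosses_def cell_edge_def using that(3,4) by blast
  qed
  have cr': "crosses (cell_edge u) (cell_edge v)" if uv: "u \<in> set vs" "v \<in> set vs" "u \<noteq> v" for u v
  proof -
    obtain i j where ij: "i < length vs" "j < length vs" "u = vs ! i" "v = vs ! j"
      using uv(1,2) by (auto simp: in_set_conv_nth)
    have *: "fst (vs!i) < fst (vs!j) \<and> snd (vs!i) < snd (vs!j)" if "i < j" "j < length vs" for i j
      using sorted_wrt_nth_less[OF vs(1)[unfolded chain_def] that] by simp
    have sym: "crosses e f \<Longrightarrow> crosses f e" for e f unfolding crosses_def by blast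
    from ij uv have "i < j \<or> j < i" using nat_neq_iff by blast
    then show ?thesis
    proof
      assume "i < j" then show ?thesis using cr[OF uv(1,2)] * ij by blast
    next
      assume "j < i" then show ?thesis using cr[OF uv(2,1)] * ij sym by blast
    qed
  qed
  have ne: "\<not> crosses e e" if "e \<noteq> {}" for e using crosses_disjoint[of e e] that by auto
  have inj: "inj_on cell_edge (set vs)"
    using cr' ne unfolding inj_on_def cell_edge_def by (metis insert_not_empty)
  have "distinct vs" using vs(1) unfolding chain_def
    by (induction vs) auto
  then have "card (cell_edge ` set vs) = k + 1"
    using card_image[OF inj] lv distinct_card by metis
  moreover have "cell_edge ` set vs \<subseteq> T" using vs(2) inT by auto
  moreover have "pairwise crosses (cell_edge ` set vs)"
    using cr' by (auto simp: pairwise_def)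
  ultimately show False using cf T unfolding crossing_free_def is_crossing_def by blast
qed

lemma finite_edges: "finite (edges n)"
proof -
  have "edges n \<subseteq> Pow {..<n}" by (auto simp: edges_def)
  then show ?thesis by (rule finite_subset) simp
qed

text \<open>By maximality, adding the missing edge creates a \<open>(k + 1)\<close>-crossing through
  it. Written as a chain, this crossing splits at the cell \<open>(x, y)\<close> into
  \<open>us\<close> before and \<open>vs\<close> after.\<close>

lemma missing_edge_chains:
  assumes kt: "k_triangulation n k T" and xy: "x < y" "y < n" "{x, y} \<notin> T"
  obtains c us vs where "x < c" "c \<le> y" "k < c" "c < n - k" "length us + length vs = k"
    "chain us" "\<forall>u\<in>set us. cell_edge u \<in> T \<and> fst u < x \<and> c \<le> snd u \<and> snd u < y"
    "chain vs" "\<forall>v\<in>set vs. cell_edge v \<in> T \<and> x < fst v \<and> fst v < c \<and> y < snd v \<and> snd v < n"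
proof -
  have T: "T \<subseteq> edges n" "crossing_free n (k + 1) T" using kt by (auto simp: k_triangulation_def)
  have e: "{x, y} \<in> edges n" unfolding edges_def using xy(1,2) less_trans nat_neq_iff by blast
  then have "\<not> crossing_free n (k + 1) (insert {x, y} T)"
    using kt xy unfolding k_triangulation_def by blast
  then obtain X where X: "X \<subseteq> insert {x, y} T" "X \<subseteq> edges n" "card X = k + 1" "pairwise crosses X"
    unfolding crossing_free_def is_crossing_def by blast
  have eX: "{x, y} \<in> X" using X T(2) unfolding crossing_free_def is_crossing_def by blast
  have "finite X" using X(2) finite_edges finite_subset by blast
  with X obtain ws where ws: "chain ws" "cell_edge ` set ws = X" "length ws = k + 1"
    "\<And>u v. u \<in> set ws \<Longrightarrow> v \<in> set ws \<Longrightarrow> fst u < snd v"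
    using crossing_imp_chain by metis
  obtain w where w: "w \<in> set ws" "cell_edge w = {x, y}" using eX ws(2) by force
  have w': "w = (x, y)" using w ws(4)[of w w] xy by (cases w) (auto simp: cell_edge_def doubleton_eq_iff)
  obtain us vs where split: "ws = us @ (x, y) # vs" using w w' split_list by metis
  \<comment> \<open>Just past the largest column, hence not above any row. The \<open>k + 1\<close>
    distinct columns below \<open>c\<close> and the \<open>k + 1\<close> distinct rows from
    \<open>c\<close> on give the bounds on \<open>c\<close>.\<close>
  define c where "c = Suc (Max (fst ` set ws))"
  have c1: "fst u < c" if "u \<in> set ws" for u
    unfolding c_def using that by (simp add: less_Suc_eq_le)
  have "Max (fst ` set ws) \<in> fst ` set ws" using split by (intro Max_in) auto
  then have c2: "c \<le> snd u" if "u \<in> set ws" for u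
    unfolding c_def using that ws(4) by (metis Suc_leI imageE)
  have sn: "snd u < n" if "u \<in> set ws" for u
  proof -
    have "cell_edge u \<in> edges n" using that ws(2) X(2) by auto
    then show ?thesis unfolding cell_edge_def edges_def by (auto simp: doubleton_eq_iff)
  qed
  have "length ws \<le> c - 0" using c1 ws(1) by (intro chain_length_le_fst) auto
  then have kc: "k < c" using ws(3) by simp
  have "length ws \<le> n - c" using c2 sn ws(1) by (intro chain_length_le_snd) auto
  then have nc: "c < n - k" using ws(3) by simp
  have ch: "chain us" "chain vs" "\<forall>u\<in>set us. fst u < x \<and> snd u < y"
    "\<forall>v\<in>set vs. x < fst v \<and> y < snd v"
    using ws(1) unfolding split chain_append chain_Cons by auto
  have inT: "cell_edge u \<in> T" if "u \<in> set ws" "u \<noteq> (x, y)" for u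
  proof -
    have "fst u \<noteq> x" using that ws(1) split ch by auto
    moreover have "fst u < snd u" using ws(4) that by blast
    ultimately have "cell_edge u \<noteq> {x, y}" using xy unfolding cell_edge_def
      by (auto simp: doubleton_eq_iff)
    then show ?thesis using that ws(2) X(1) by auto
  qed
  show thesis
  proof
    show "x < c" "c \<le> y" using c1[of "(x,y)"] c2[of "(x,y)"] split by auto
    show "k < c" "c < n - k" by fact+
    show "length us + length vs = k" using ws(3) split by simp
    show "chain us" "chain vs" by fact+
    show "\<forall>u\<in>set us. cell_edge u \<in> T \<and> fst u < x \<and> c \<le> snd u \<and> snd u < y"
      using ch inT c2 unfolding split by fastforce
    show "\<forall>v\<in>set vs. cell_edge v \<in> T \<and> x < fst v \<and> fst v < c \<and> y < snd v \<and> snd v < n"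
      using ch inT c1 sn unfolding split by fastforce
  qed
qed

text \<open>The rows of \<open>us\<close> and the columns of \<open>vs\<close> fit between
  \<open>x\<close> and \<open>y\<close>; the columns of \<open>us\<close> and the rows of
  \<open>vs\<close> fit outside. Together the two chains have \<open>k\<close> cells.\<close>

lemma missing_edge_length:
  assumes "k_triangulation n k T" "x < y" "y < n" "{x, y} \<notin> T"
  shows "k < y - x" "y - x < n - k"
proof -
  obtain c us vs where c: "x < c" "c \<le> y" "length us + length vs = k"
    and us: "chain us" "\<forall>u\<in>set us. cell_edge u \<in> T \<and> fst u < x \<and> c \<le> snd u \<and> snd u < y"
    and vs: "chain vs" "\<forall>v\<in>set vs. cell_edge v \<in> T \<and> x < fst v \<and> fst v < c \<and> y < snd v \<and> snd v < n"
    using missing_edge_chains[OF assms] by metis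
  have "length us \<le> x - 0" "length us \<le> y - c" "length vs \<le> c - Suc x" "length vs \<le> n - Suc y"
    using us vs by (intro chain_length_le_fst chain_length_le_snd; force)+
  then show "k < y - x" "y - x < n - k" using c assms by linarith+
qed

section \<open>Longest chains\<close>

text \<open>The usual recursion for longest chains. The arguments \<open>x\<close> and
  \<open>y\<close> are corners, that is, exclusive bounds; the cell \<open>(x, y)\<close> sits
  between the corners \<open>(x, y)\<close> and \<open>(Suc x, Suc y)\<close>.\<close>

fun lpp :: "nat set set \<Rightarrow> nat \<Rightarrow> nat \<Rightarrow> nat \<Rightarrow> nat" where
  "lpp T c 0 y = 0"
| "lpp T c (Suc x) 0 = 0"
| "lpp T c (Suc x) (Suc y) = (if y < c then 0 else
     max (max (lpp T c x (Suc y)) (lpp T c (Suc x) y))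
       (lpp T c x y + (if {x, y} \<in> T then 1 else 0)))"

lemma lpp_no_rows [simp]: "y \<le> c \<Longrightarrow> lpp T c x y = 0"
  by (cases x; cases y) auto

lemma lpp_rec:
  "c \<le> y \<Longrightarrow> lpp T c (Suc x) (Suc y) = max (max (lpp T c x (Suc y)) (lpp T c (Suc x) y))
       (lpp T c x y + (if {x, y} \<in> T then 1 else 0))"
  by simp

declare lpp.simps [simp del]

lemma lpp_no_cols [simp]: "lpp T c 0 y = 0"
  by (simp add: lpp.simps)

definition box :: "nat set set \<Rightarrow> nat \<Rightarrow> nat \<Rightarrow> nat \<Rightarrow> (nat \<times> nat) set" where
  "box T c x y = {u. cell_edge u \<in> T \<and> fst u < x \<and> c \<le> snd u \<and> snd u < y}"

lemma chain_le_lpp: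
  assumes "chain us" "set us \<subseteq> box T c x y"
  shows "length us \<le> lpp T c x y"
  using assms
proof (induction T c x y arbitrary: us rule: lpp.induct)
  case (3 T c x y)
  show ?case
  proof (cases "us = []")
    case False
    then obtain vs v where us: "us = vs @ [v]" by (metis append_butlast_last_id)
    have v: "cell_edge v \<in> T" "fst v \<le> x" "c \<le> snd v" "snd v \<le> y"
      using 3(5) by (auto simp: us box_def)
    have vs: "chain vs" "\<forall>u\<in>set vs. fst u < fst v \<and> snd u < snd v"
      using 3(4) by (auto simp: us chain_append)
    have cy: "\<not> y < c" using v by simp
    consider "fst v < x" | "snd v < y" | "v = (x, y)" using v by (cases v) fastforce
    then show ?thesis
    proof cases
      case 1
      then have "set us \<subseteq> box T c x (Suc y)" using 3(5) vs(2) by (force simp: us box_def)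
      from 3(1)[OF cy 3(4) this] show ?thesis using cy by (simp add: lpp_rec)
    next
      case 2
      then have "set us \<subseteq> box T c (Suc x) y" using 3(5) vs(2) by (force simp: us box_def)
      from 3(2)[OF cy 3(4) this] show ?thesis using cy by (simp add: lpp_rec)
    next
      case eq: 3
      then have "set vs \<subseteq> box T c x y" using 3(5) vs(2) by (force simp: us box_def)
      from 3(3)[OF cy vs(1) this] show ?thesis using cy v eq
        by (simp add: lpp_rec us cell_edge_def)
    qed
  qed simp
qed (auto simp: box_def)

lemma lpp_attained:
  obtains us where "chain us" "set us \<subseteq> box T c x y" "length us = lpp T c x y"
proof -
  have "\<exists>us. chain us \<and> set us \<subseteq> box T c x y \<and> length us = lpp T c x y"
  proof (induction T c x y rule: lpp.induct)
    case (3 T c x y)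
    show ?case
    proof (cases "y < c")
      case True
      then show ?thesis by (intro exI[of _ "[]"]) simp
    next
      case False
      have mono: "box T c x (Suc y) \<subseteq> box T c (Suc x) (Suc y)" "box T c (Suc x) y \<subseteq> box T c (Suc x) (Suc y)"
        "box T c x y \<subseteq> box T c (Suc x) (Suc y)" by (auto simp: box_def)
      consider "lpp T c (Suc x) (Suc y) = lpp T c x (Suc y)" | "lpp T c (Suc x) (Suc y) = lpp T c (Suc x) y"
        | "lpp T c (Suc x) (Suc y) = lpp T c x y"
        | "lpp T c (Suc x) (Suc y) = lpp T c x y + 1" "{x, y} \<in> T"
      proof -
        have "lpp T c (Suc x) (Suc y) = lpp T c x (Suc y) \<or> lpp T c (Suc x) (Suc y) = lpp T c (Suc x) y \<or>
          lpp T c (Suc x) (Suc y) = lpp T c x y \<or> lpp T c (Suc x) (Suc y) = lpp T c x y + 1 \<and> {x, y} \<in> T"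
          using False by (auto simp: lpp_rec max_def)
        then show thesis using that by blast
      qed
      then show ?thesis
      proof cases
        case 4
        obtain us where us: "chain us" "set us \<subseteq> box T c x y" "length us = lpp T c x y"
          using 3(3)[OF False] by blast
        have "chain (us @ [(x, y)])" "set (us @ [(x, y)]) \<subseteq> box T c (Suc x) (Suc y)"
          using us 4 False by (auto simp: chain_append chain_Cons box_def cell_edge_def)
        then show ?thesis using us(3) 4 by (intro exI[of _ "us @ [(x, y)]"]) simp
      qed (use 3 mono False in \<open>metis subset_trans\<close>)+
    qed
  qed (auto intro!: exI[of _ "[]"])
  then show thesis using that by blast
qed

lemma lpp_le:
  assumes "box T c x y \<subseteq> box T c' x' y'"
  shows "lpp T c x y \<le> lpp T c' x' y'"
  using assms chain_le_lpp lpp_attained by (metis subset_trans)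

lemma lpp_le_cols: "lpp T c x y \<le> x"
  using lpp_attained[of T c x y] chain_length_le_fst[of _ 0 x]
  by (metis (mono_tags, lifting) box_def diff_zero le0 mem_Collect_eq subset_code(1))

lemma lpp_le_rows: "lpp T c x y \<le> y - c"
  using lpp_attained[of T c x y] chain_length_le_snd[of _ c y]
  by (metis (mono_tags, lifting) box_def mem_Collect_eq subset_code(1))

text \<open>A chain has at most one cell in each column and each row.\<close>

lemma lpp_incr:
  "lpp T c x y \<le> lpp T c (Suc x) y" "lpp T c (Suc x) y \<le> Suc (lpp T c x y)"
  "lpp T c x y \<le> lpp T c x (Suc y)" "lpp T c x (Suc y) \<le> Suc (lpp T c x y)"
proof -
  show "lpp T c x y \<le> lpp T c (Suc x) y" "lpp T c x y \<le> lpp T c x (Suc y)"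
    by (rule lpp_le; auto simp: box_def)+
  have "lpp T c (Suc x) y \<le> Suc (lpp T c x y) \<and> lpp T c x (Suc y) \<le> Suc (lpp T c x y)"
  proof (induction "x + y" arbitrary: x y rule: less_induct)
    case less
    have 1: "lpp T c (Suc x) y \<le> Suc (lpp T c x y)"
    proof (cases "y \<le> c")
      case False
      then obtain y' where y: "y = Suc y'" "c \<le> y'" by (cases y) auto
      have "lpp T c (Suc x) y' \<le> Suc (lpp T c x y')" using less[of x y'] y by simp
      moreover have "lpp T c x y' \<le> lpp T c x y" unfolding y by (rule lpp_le) (auto simp: box_def)
      ultimately show ?thesis using y by (simp add: lpp_rec)
    qed simp
    have 2: "lpp T c x (Suc y) \<le> Suc (lpp T c x y)"
    proof (cases "x = 0 \<or> y < c")
      case False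
      then obtain x' where x: "x = Suc x'" "c \<le> y" by (cases x) auto
      have "lpp T c x' (Suc y) \<le> Suc (lpp T c x' y)" using less[of x' y] x by simp
      moreover have "lpp T c x' y \<le> lpp T c x y" unfolding x by (rule lpp_le) (auto simp: box_def)
      ultimately show ?thesis using x by (simp add: lpp_rec)
    qed auto
    from 1 2 show ?case ..
  qed
  then show "lpp T c (Suc x) y \<le> Suc (lpp T c x y)" "lpp T c x (Suc y) \<le> Suc (lpp T c x y)" by auto
qed

text \<open>The increments of \<open>lpp\<close> encode which staircases pass between neighbouring corners: column
  increments decrease and row increments increase with the lower row bound \<open>c\<close>.\<close>

lemma lpp_exchange_step:
  assumes "Suc c \<le> y"
  shows "lpp T (Suc c) (Suc x) y + lpp T c x y \<le> lpp T c (Suc x) y + lpp T (Suc c) x y \<and>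
    lpp T c x (Suc y) + lpp T (Suc c) x y \<le> lpp T (Suc c) x (Suc y) + lpp T c x y"
  using assms
proof (induction "x + y" arbitrary: x y rule: less_induct)
  case less
  have 1: "lpp T (Suc c) (Suc x) y + lpp T c x y \<le> lpp T c (Suc x) y + lpp T (Suc c) x y"
  proof (cases "y = Suc c")
    case True
    then show ?thesis using lpp_incr(1)[of T c x y] by simp
  next
    case False
    then obtain y' where y: "y = Suc y'" "Suc c \<le> y'" using less(2) by (cases y) auto
    \<comment> \<open>If \<open>h\<close> and \<open>v\<close> are the increments on the bottom and
      left sides of a unit square and \<open>e\<close> is 1 or 0 as its cell is in \<open>T\<close>
      or not, the increment on the top side is \<open>max h e - v\<close>, truncated at 0. It grows
      with \<open>h\<close> and falls with \<open>v\<close>, so the comparison passes across the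
      square.\<close>
    have "lpp T (Suc c) (Suc x) y' + lpp T c x y' \<le> lpp T c (Suc x) y' + lpp T (Suc c) x y' \<and>
      lpp T c x (Suc y') + lpp T (Suc c) x y' \<le> lpp T (Suc c) x (Suc y') + lpp T c x y'"
      using less(1)[of x y'] y by simp
    then show ?thesis
      using y(2) lpp_incr[of T c x y'] lpp_incr[of T "Suc c" x y'] unfolding y(1)
      by (auto simp: lpp_rec max_def)
  qed
  have 2: "lpp T c x (Suc y) + lpp T (Suc c) x y \<le> lpp T (Suc c) x (Suc y) + lpp T c x y"
  proof (cases x)
    case (Suc x')
    have "lpp T (Suc c) (Suc x') y + lpp T c x' y \<le> lpp T c (Suc x') y + lpp T (Suc c) x' y \<and>
      lpp T c x' (Suc y) + lpp T (Suc c) x' y \<le> lpp T (Suc c) x' (Suc y) + lpp T c x' y"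
      using less(1)[of x' y] less(2) Suc by simp
    then show ?thesis
      using less(2) lpp_incr[of T c x' y] lpp_incr[of T "Suc c" x' y] unfolding Suc
      by (auto simp: lpp_rec max_def)
  qed auto
  from 1 2 show ?case ..
qed

lemma lpp_col_incr_antimono:
  assumes "c \<le> d" "d \<le> y"
  shows "lpp T d (Suc x) y + lpp T c x y \<le> lpp T c (Suc x) y + lpp T d x y"
  using assms
proof (induction d rule: dec_induct)
  case (step d)
  then show ?case using lpp_exchange_step[of d y T x] by simp
qed simp

lemma lpp_row_incr_mono:
  assumes "c \<le> d" "d \<le> y"
  shows "lpp T c x (Suc y) + lpp T d x y \<le> lpp T d x (Suc y) + lpp T c x y"
  using assms
proof (induction d rule: dec_induct)
  case (step d)
  then show ?case using lpp_exchange_step[of d y T x] by simp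
qed simp

text \<open>Equal to \<open>1\<close> if the corner \<open>(x, y)\<close> lies below the staircase of \<open>m\<close>, and to \<open>0\<close> otherwise.\<close>

definition dlt :: "nat set set \<Rightarrow> nat \<Rightarrow> nat \<Rightarrow> nat \<Rightarrow> nat" where
  "dlt T m x y = lpp T m x y - lpp T (Suc m) x y"

lemma lpp_Suc_le: "lpp T (Suc m) x y \<le> lpp T m x y"
  by (rule lpp_le) (auto simp: box_def)

lemma lpp_eq_dlt: "lpp T m x y = lpp T (Suc m) x y + dlt T m x y"
  using lpp_Suc_le[of T m x y] by (simp add: dlt_def)

lemma dlt_mono_col_Suc: "dlt T m x y \<le> dlt T m (Suc x) y"
proof (cases "Suc m \<le> y")
  case True
  then show ?thesis
    using lpp_exchange_step[of m y T x] lpp_eq_dlt[of T m x y] lpp_eq_dlt[of T m "Suc x" y] by linarith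
qed (auto simp: dlt_def)

lemma dlt_antimono_row_Suc: "Suc m \<le> y \<Longrightarrow> dlt T m x (Suc y) \<le> dlt T m x y"
  using lpp_exchange_step[of m y T x] lpp_eq_dlt[of T m x y] lpp_eq_dlt[of T m x "Suc y"] by linarith

lemma dlt_mono_col: "x \<le> x' \<Longrightarrow> dlt T m x y \<le> dlt T m x' y"
  by (rule lift_Suc_mono_le[of "\<lambda>x. dlt T m x y"]) (rule dlt_mono_col_Suc)

lemma dlt_antimono_row:
  assumes "m < y" "y \<le> y'"
  shows "dlt T m x y' \<le> dlt T m x y"
  using assms(2,1)
proof (induction y' rule: dec_induct)
  case (step i)
  then show ?case using dlt_antimono_row_Suc[of m i T x] by simp
qed simp

text \<open>The value is largest at \<open>y = Suc m\<close>, where \<open>m\<close> is the only row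
  available.\<close>

lemma dlt_le_1: "dlt T m x y \<le> 1"
proof (cases "m < y")
  case True
  then have "dlt T m x y \<le> dlt T m x (Suc m)" by (intro dlt_antimono_row) auto
  also have "\<dots> \<le> 1" using lpp_le_rows[of T m x "Suc m"] by (simp add: dlt_def)
  finally show ?thesis .
qed (simp add: dlt_def)

lemma sum_dlt:
  assumes "c \<le> d"
  shows "lpp T c x y = lpp T d x y + (\<Sum>m\<in>{c..<d}. dlt T m x y)"
  using assms
proof (induction d rule: dec_induct)
  case (step d)
  then show ?case using lpp_eq_dlt[of T d x y] by simp
qed simp

section \<open>Stars of a k-triangulation\<close>

lemma k_triangulationD:
  assumes "k_triangulation n k T"
  shows "T \<subseteq> edges n" "crossing_free n (k + 1) T"
  using assms by (auto simp: k_triangulation_def)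

text \<open>The form in which maximality is used below. The chain \<open>vs\<close> prolongs every
  chain in the larger box, so such a chain has at most \<open>k - length vs\<close> cells, which is
  the length of \<open>us\<close>, and \<open>us\<close> lies in the smaller box.\<close>

lemma missing_edge_lpp:
  assumes kt: "k_triangulation n k T" and xy: "x < y" "y < n" "{x, y} \<notin> T"
  obtains c where "x < c" "c \<le> y" "k < c" "c < n - k" "lpp T c (Suc x) (Suc y) = lpp T c x y"
proof -
  obtain c us vs where c: "x < c" "c \<le> y" "k < c" "c < n - k" "length us + length vs = k"
    and us: "chain us" "\<forall>u\<in>set us. cell_edge u \<in> T \<and> fst u < x \<and> c \<le> snd u \<and> snd u < y"
    and vs: "chain vs" "\<forall>v\<in>set vs. cell_edge v \<in> T \<and> x < fst v \<and> fst v < c \<and> y < snd v \<and> snd v < n"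
    using missing_edge_chains[OF kt xy] by metis
  have le: "length us \<le> lpp T c x y" using us by (intro chain_le_lpp) (auto simp: box_def)
  obtain ws where ws: "chain ws" "set ws \<subseteq> box T c (Suc x) (Suc y)"
    "length ws = lpp T c (Suc x) (Suc y)" by (rule lpp_attained)
  have "length (ws @ vs) \<le> k"
  proof (rule chain_length_le[OF k_triangulationD(2,1)[OF kt]])
    show "chain (ws @ vs)"
      using ws(1,2) vs by (fastforce simp: chain_append box_def)
    show "\<forall>u\<in>set (ws @ vs). cell_edge u \<in> T \<and> fst u < c \<and> c \<le> snd u"
      using ws(2) vs c by (fastforce simp: box_def)
  qed
  then have "lpp T c (Suc x) (Suc y) \<le> lpp T c x y" using le c(5) ws(3) by simp
  moreover have "lpp T c x y \<le> lpp T c (Suc x) (Suc y)" by (rule lpp_le) (auto simp: box_def)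
  ultimately show thesis using c that by simp
qed

lemma lpp_ge_diagonal:
  assumes "\<And>i. i < t \<Longrightarrow> {a + i, b + i} \<in> T" "a + t \<le> x" "c \<le> b" "b + t \<le> y"
  shows "t \<le> lpp T c x y"
proof -
  have "length (map (\<lambda>i. (a + i, b + i)) [0..<t]) \<le> lpp T c x y"
    using assms by (intro chain_le_lpp chain_map_upt) (auto simp: box_def cell_edge_def)
  then show ?thesis by simp
qed

lemma lpp_le_k:
  assumes "k_triangulation n k T" "x \<le> c"
  shows "lpp T c x y \<le> k"
proof -
  obtain us where us: "chain us" "set us \<subseteq> box T c x y" "length us = lpp T c x y" by (rule lpp_attained)
  then show ?thesis using chain_length_le[OF k_triangulationD(2,1)[OF assms(1)] us(1), of c] assms(2)
    by (fastforce simp: box_def)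
qed

section \<open>Values of \<open>lpp\<close> that are the same for all k-triangulations\<close>

lemma short_edge_mem:
  "k_triangulation n k T \<Longrightarrow> x < y \<Longrightarrow> y < n \<Longrightarrow> y - x \<le> k \<Longrightarrow> {x, y} \<in> T"
  using missing_edge_length(1) by fastforce

lemma long_edge_mem:
  "k_triangulation n k T \<Longrightarrow> x < y \<Longrightarrow> y < n \<Longrightarrow> n - k \<le> y - x \<Longrightarrow> {x, y} \<in> T"
  using missing_edge_length(2) by fastforce

text \<open>The upper bound is attained by a diagonal of edges of length at most \<open>k\<close>,
  which lie in every k-triangulation.\<close>

lemma lpp_bottom:
  assumes kt: "k_triangulation n k T" and "x \<le> c" "c \<le> max k x" "y \<le> n"
  shows "lpp T c x y = min k (min x (y - c))"
proof (cases "y \<le> c")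
  case False
  show ?thesis
  proof (rule antisym)
    show "lpp T c x y \<le> min k (min x (y - c))"
      using lpp_le_k[OF kt assms(2)] lpp_le_cols lpp_le_rows by simp
    define t where "t = min k (min x (y - c))"
    have "t \<le> lpp T c x y"
    proof (rule lpp_ge_diagonal)
      fix i assume i: "i < t"
      show "{x - t + i, c + i} \<in> T"
        by (rule short_edge_mem[OF kt]) (use assms i in \<open>auto simp: t_def\<close>)
    qed (use assms False in \<open>auto simp: t_def\<close>)
    then show "min k (min x (y - c)) \<le> lpp T c x y" by (simp add: t_def)
  qed
qed simp

text \<open>As for \<open>lpp_bottom\<close>, now with a diagonal of edges of length at least
  \<open>n - k\<close>.\<close>

lemma lpp_top:
  assumes kt: "k_triangulation n k T" and "2 * k + 1 \<le> n" "n - k \<le> c" "y \<le> n"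
  shows "lpp T c x y = min x (y - c)"
proof (cases "y \<le> c")
  case False
  show ?thesis
  proof (rule antisym)
    show "lpp T c x y \<le> min x (y - c)"
      using lpp_le_cols lpp_le_rows by simp
    define t where "t = min x (y - c)"
    have "t \<le> lpp T c x y"
    proof (rule lpp_ge_diagonal)
      fix i assume i: "i < t"
      show "{0 + i, y - t + i} \<in> T"
        by (rule long_edge_mem[OF kt]) (use assms i in \<open>auto simp: t_def\<close>)
    qed (use assms False in \<open>auto simp: t_def\<close>)
    then show "min x (y - c) \<le> lpp T c x y" by (simp add: t_def)
  qed
qed simp

lemma lpp_full:
  assumes kt: "k_triangulation n k T" and n: "2 * k + 1 \<le> n" and "c \<le> n - k" "x \<le> c"
  shows "lpp T c x n = min k x"
proof (rule antisym)
  show "lpp T c x n \<le> min k x"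
    using lpp_le_k[OF kt assms(4)] lpp_le_cols by simp
  have "lpp T (n - k) x n \<le> lpp T c x n" using assms(3) by (intro lpp_le) (auto simp: box_def)
  then show "min k x \<le> lpp T c x n" using lpp_top[OF kt n, of "n - k" n x] n by simp
qed

text \<open>The row on which the staircase of \<open>m\<close> passes from column \<open>x - 1\<close> to column \<open>x\<close>.\<close>

definition height :: "nat set set \<Rightarrow> nat \<Rightarrow> nat \<Rightarrow> nat" where
  "height T m x = (LEAST y. m \<le> y \<and> dlt T m x (Suc y) = 0)"

section \<open>The staircase with middle vertex \<open>m\<close> and its star\<close>

context
  fixes n k :: nat and T :: "nat set set" and m :: nat
  assumes kt: "k_triangulation n k T" and n: "2 * k + 1 \<le> n" and m: "k \<le> m" "m < n - k"
begin

lemma height_props: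
  assumes "x \<le> m"
  shows "m \<le> height T m x" "height T m x < n" "dlt T m x (Suc (height T m x)) = 0"
proof -
  \<comment> \<open>At the top row both bounds allow the full length \<open>min k x\<close>, so the
    minimum in the definition of \<open>height\<close> exists.\<close>
  have "dlt T m x n = 0"
    unfolding dlt_def using lpp_full[OF kt n, of m x] lpp_full[OF kt n, of "Suc m" x] m assms by simp
  then have ex: "m \<le> n - 1 \<and> dlt T m x (Suc (n - 1)) = 0" using m by simp
  from LeastI[of "\<lambda>y. m \<le> y \<and> dlt T m x (Suc y) = 0", OF ex]
  show "m \<le> height T m x" "dlt T m x (Suc (height T m x)) = 0" unfolding height_def by auto
  have "height T m x \<le> n - 1" unfolding height_def using ex by (rule Least_le)
  then show "height T m x < n" using m by simp
qed

lemma dlt_height: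
  assumes "x \<le> m" "m < y"
  shows "dlt T m x y = (if y \<le> height T m x then 1 else 0)"
proof (cases "y \<le> height T m x")
  case True
  then have "\<not> (m \<le> y - 1 \<and> dlt T m x (Suc (y - 1)) = 0)"
    unfolding height_def using assms(2) by (intro not_less_Least) auto
  then show ?thesis using True assms dlt_le_1[of T m x y] by (auto simp: le_Suc_eq)
next
  case False
  then have "dlt T m x y \<le> dlt T m x (Suc (height T m x))"
    using height_props[OF assms(1)] by (intro dlt_antimono_row) auto
  then show ?thesis using False height_props[OF assms(1)] by simp
qed

lemma lpp_height:
  "x \<le> m \<Longrightarrow> m < y \<Longrightarrow> lpp T m x y = lpp T (Suc m) x y + (if y \<le> height T m x then 1 else 0)"
  using lpp_eq_dlt[of T m x y] dlt_height by simp

lemma height_0: "height T m 0 = m"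
  unfolding height_def by (rule Least_equality) (auto simp: dlt_def)

lemma height_mono_Suc:
  assumes "x < m"
  shows "height T m x \<le> height T m (Suc x)"
proof (rule ccontr)
  let ?h = "Suc (height T m (Suc x))"
  assume "\<not> ?thesis"
  then have "dlt T m x ?h = 1" using assms height_props[of "Suc x"] by (subst dlt_height) auto
  moreover have "dlt T m (Suc x) ?h = 0" using assms height_props[of "Suc x"] by simp
  ultimately show False using dlt_mono_col_Suc[of T m x ?h] by simp
qed

lemma height_mono: "x \<le> x' \<Longrightarrow> x' \<le> m \<Longrightarrow> height T m x \<le> height T m x'"
proof (induction x' rule: dec_induct)
  case (step i)
  then show ?case using height_mono_Suc[of i] by simp
qed simp

lemma lpp_height_stay:
  assumes "x < m" and eq: "height T m (Suc x) = height T m x"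
  shows "lpp T m (Suc x) (height T m x) = lpp T m x (height T m x)"
proof (cases "height T m x = m")
  case False
  define y where "y = height T m x"
  have my: "m < y" using False height_props(1)[of x] assms(1) by (simp add: y_def)
  note u = lpp_height[of x y] lpp_height[of "Suc x" y] lpp_height[of x "Suc y"] lpp_height[of "Suc x" "Suc y"]
  note i = lpp_incr[of T m x y] lpp_incr[of T "Suc m" x y] lpp_incr[of T m "Suc x" y]
    lpp_incr[of T "Suc m" "Suc x" y]
  \<comment> \<open>At \<open>x\<close> and at \<open>Suc x\<close>, \<open>dlt\<close> drops from 1
    to 0 when row \<open>y\<close> is passed, which forces \<open>lpp T (Suc m)\<close> up by one. A
    column increment at \<open>y\<close> would then put opposite corners of a unit square two apart,
    against the recursion.\<close>
  have "lpp T (Suc m) (Suc x) (Suc y) \<le> max (max (lpp T (Suc m) x (Suc y)) (lpp T (Suc m) (Suc x) y))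
       (lpp T (Suc m) x y + 1)" using my by (subst lpp_rec) auto
  then show ?thesis using u i my assms unfolding eq y_def[symmetric] by (auto simp: max_def split: if_splits)
qed simp

text \<open>If a turning cell were missing, \<open>lpp T c\<close> would agree at its four corners
  for some \<open>c\<close>. Column increments decrease and row increments increase with the bound;
  so \<open>c \<le> m\<close> contradicts a column increment for \<open>m\<close>, and
  \<open>c > m\<close> contradicts a row increment for \<open>Suc m\<close> at the lower turn and
  for \<open>m\<close> at the upper one.\<close>

lemma height_jump:
  assumes x: "x < m" and lt: "height T m x < height T m (Suc x)"
  shows "{x, height T m x} \<in> T" "{x, height T m (Suc x)} \<in> T"
    "lpp T m (Suc x) (height T m (Suc x)) = Suc (lpp T m x (height T m x))"
proof -
  define y0 y1 where "y0 = height T m x" and "y1 = height T m (Suc x)"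
  have y: "m \<le> y0" "y0 < y1" "y1 < n"
    using height_props[of x] height_props[of "Suc x"] assms by (auto simp: y0_def y1_def)
  have h: "lpp T m x y = lpp T (Suc m) x y + (if y \<le> y0 then 1 else 0)"
    "lpp T m (Suc x) y = lpp T (Suc m) (Suc x) y + (if y \<le> y1 then 1 else 0)" if "m < y" for y
    using lpp_height[of x y] lpp_height[of "Suc x" y] x that by (auto simp: y0_def y1_def)
  \<comment> \<open>Along the vertical stretch \<open>dlt\<close> is 0 at \<open>x\<close> and 1 at
    \<open>Suc x\<close>, so the whole change is a column increment for \<open>m\<close>.\<close>
  have mid: "lpp T m (Suc x) y = Suc (lpp T m x y)" "lpp T (Suc m) (Suc x) y = lpp T (Suc m) x y"
    if "y0 < y" "y \<le> y1" for y
    using h[of y] that y lpp_incr[of T m x y] lpp_incr[of T "Suc m" x y] by auto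
  have const0: "lpp T m x (Suc y0) = lpp T m x y0"
  proof (cases "y0 = m")
    case True
    then show ?thesis using h(1)[of "Suc m"] by simp
  next
    case False
    then show ?thesis using h(1)[of y0] h(1)[of "Suc y0"] y lpp_incr[of T "Suc m" x y0] lpp_incr[of T m x y0] by simp
  qed
  show T0: "{x, height T m x} \<in> T"
  proof (rule ccontr)
    assume "\<not> ?thesis"
    then have nT: "{x, y0} \<notin> T" by (simp add: y0_def)
    obtain c where c: "x < c" "c \<le> y0" "lpp T c (Suc x) (Suc y0) = lpp T c x y0"
      using missing_edge_lpp[OF kt _ _ nT] y x by (metis le_less_trans less_trans order.strict_trans2)
    have c': "lpp T c x (Suc y0) = lpp T c x y0" "lpp T c (Suc x) y0 = lpp T c x y0"
      using c(3) lpp_incr[of T c x y0] lpp_incr(1)[of T c x "Suc y0"] lpp_incr(3)[of T c "Suc x" y0] by auto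
    have rec: "lpp T m (Suc x) (Suc y0) = max (lpp T m x (Suc y0)) (lpp T m (Suc x) y0)"
      using y nT lpp_incr(1)[of T m x y0] by (auto simp: lpp_rec max_def)
    have bot: "lpp T m (Suc x) y0 = Suc (lpp T m x y0)"
      using rec const0 mid(1)[of "Suc y0"] y by (auto simp: max_def split: if_splits)
    then have my: "m < y0" using y by (cases "y0 = m") auto
    show False
    proof (cases "c \<le> m")
      case True
      then show ?thesis using lpp_col_incr_antimono[of c m y0 T x] bot c'(2) y by simp
    next
      case False
      have "lpp T (Suc m) x (Suc y0) = Suc (lpp T (Suc m) x y0)"
        using const0 h(1)[of y0] h(1)[of "Suc y0"] my by simp
      then show ?thesis using lpp_row_incr_mono[of "Suc m" c y0 T x] c'(1) c(2) False by simp
    qed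
  qed
  show "{x, height T m (Suc x)} \<in> T"
  proof (rule ccontr)
    assume "\<not> ?thesis"
    then have nT: "{x, y1} \<notin> T" by (simp add: y1_def)
    obtain c where c: "x < c" "c \<le> y1" "lpp T c (Suc x) (Suc y1) = lpp T c x y1"
      using missing_edge_lpp[OF kt _ _ nT] y x by (metis le_less_trans less_trans order.strict_trans2)
    have c': "lpp T c x (Suc y1) = lpp T c x y1" "lpp T c (Suc x) y1 = lpp T c x y1"
      using c(3) lpp_incr[of T c x y1] lpp_incr(1)[of T c x "Suc y1"] lpp_incr(3)[of T c "Suc x" y1] by auto
    note m1 = mid[of y1]
    have "lpp T (Suc m) (Suc x) (Suc y1) = max (lpp T (Suc m) x (Suc y1)) (lpp T (Suc m) (Suc x) y1)"
      using y nT lpp_incr(1)[of T "Suc m" x y1] by (auto simp: lpp_rec max_def)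
    moreover have "lpp T (Suc m) (Suc x) (Suc y1) \<ge> Suc (lpp T (Suc m) x y1)"
      using h[of "Suc y1"] h[of y1] m1 y lpp_incr(3)[of T m "Suc x" y1] by simp
    ultimately have "lpp T (Suc m) x (Suc y1) = Suc (lpp T (Suc m) x y1)"
      using m1 y lpp_incr[of T "Suc m" x y1] by (auto simp: max_def split: if_splits)
    then have row: "lpp T m x (Suc y1) = Suc (lpp T m x y1)" using h(1)[of y1] h(1)[of "Suc y1"] y by simp
    show False
    proof (cases "c \<le> m")
      case True
      then show ?thesis using lpp_col_incr_antimono[of c m y1 T x] m1 c'(2) y by simp
    next
      case False
      then show ?thesis using lpp_row_incr_mono[of m c y1 T x] c'(1) c(2) row by simp
    qed
  qed
  \<comment> \<open>A row increment at \<open>x\<close> would add to the column increment from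
    \<open>mid\<close> and put opposite corners of a unit square two apart.\<close>
  have const: "lpp T m x y = lpp T m x y0" if "y0 \<le> y" "y \<le> y1" for y
    using that
  proof (induction y rule: dec_induct)
    case (step y)
    show ?case
    proof (cases "y = y0")
      case False
      then have yy: "y0 < y" "y < y1" using step by auto
      have "lpp T m (Suc x) (Suc y) \<le> max (max (lpp T m x (Suc y)) (lpp T m (Suc x) y)) (lpp T m x y + 1)"
        using yy y by (subst lpp_rec) auto
      then have "lpp T m x (Suc y) = lpp T m x y"
        using mid(1)[of y] mid(1)[of "Suc y"] yy lpp_incr[of T m x y] by (auto simp: max_def split: if_splits)
      then show ?thesis using step yy by simp
    qed (use const0 in simp)
  qed simp
  show "lpp T m (Suc x) (height T m (Suc x)) = Suc (lpp T m x (height T m x))"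
    using mid(1)[of y1] const[of y1] y unfolding y0_def y1_def by simp
qed

definition jumps :: "nat \<Rightarrow> nat list" where
  "jumps x = filter (\<lambda>x. height T m x < height T m (Suc x)) [0..<x]"

text \<open>Each turn of the staircase at the end of a horizontal stretch increases the length of a longest
  chain below it by one, and straight stretches leave it unchanged.\<close>

lemma length_jumps: "x \<le> m \<Longrightarrow> length (jumps x) = lpp T m x (height T m x)"
proof (induction x)
  case 0
  then show ?case by (simp add: jumps_def)
next
  case (Suc x)
  then show ?case
    using height_jump(3)[of x] lpp_height_stay[of x] height_mono_Suc[of x]
    by (auto simp: jumps_def le_less)
qed

text \<open>Up to row \<open>m + k\<close> short edges make a chain that uses every row from
  \<open>m\<close> on; without row \<open>m\<close> it is shorter by one.\<close>

lemma height_m_ge: "m + k \<le> height T m m"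
proof (rule ccontr)
  assume "\<not> ?thesis"
  then have lt: "height T m m < m + k" "m \<le> height T m m" using height_props(1)[of m] by auto
  then have "lpp T m m (Suc (height T m m)) = Suc (height T m m) - m"
    using lpp_bottom[OF kt, of m m "Suc (height T m m)"] m height_props(2)[of m] by simp
  moreover have "lpp T (Suc m) m (Suc (height T m m)) \<le> height T m m - m"
    using lpp_le_rows[of T "Suc m" m "Suc (height T m m)"] by simp
  ultimately show False using height_props(3)[of m] lt by (simp add: dlt_def)
qed

text \<open>The end of the staircase is high enough for the chains below it to reach the full length
  \<open>k\<close>, so there are exactly \<open>k\<close> vertical stretches.\<close>

lemma length_jumps_m: "length (jumps m) = k"
  using length_jumps[of m] lpp_bottom[OF kt, of m m "height T m m"] m height_props(2)[of m] height_m_ge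
  by simp

text \<open>The argument of \<open>height_jump\<close>, where \<open>c > m\<close> holds from the
  start and only the row increment for \<open>Suc m\<close> is compared.\<close>

lemma last_edge:
  assumes "0 < k"
  shows "{m, height T m m} \<in> T"
proof (rule ccontr)
  define y where "y = height T m m"
  assume "\<not> ?thesis"
  then have nT: "{m, y} \<notin> T" by (simp add: y_def)
  have y: "m < y" "y < n" using height_props(2)[of m] height_m_ge assms by (auto simp: y_def)
  obtain c where c: "m < c" "c \<le> y" "lpp T c (Suc m) (Suc y) = lpp T c m y"
    using missing_edge_lpp[OF kt y nT] by metis
  have c': "lpp T c m (Suc y) = lpp T c m y"
    using c(3) lpp_incr[of T c m y] lpp_incr(1)[of T c m "Suc y"] by auto
  have "lpp T (Suc m) m (Suc y) = Suc (lpp T (Suc m) m y)"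
    using lpp_height[of m y] lpp_height[of m "Suc y"] y(1) lpp_incr[of T "Suc m" m y] lpp_incr[of T m m y]
    by (simp add: y_def)
  then show False using lpp_row_incr_mono[of "Suc m" c y T m] c' c by simp
qed

lemma set_jumps: "set (jumps m) = {x. x < m \<and> height T m x < height T m (Suc x)}"
  by (auto simp: jumps_def)

lemma sorted_jumps: "sorted_wrt (<) (jumps m)"
  unfolding jumps_def by (intro sorted_wrt_filter) simp

lemma height_const:
  assumes "a \<le> b" "b \<le> m" "\<And>x. a \<le> x \<Longrightarrow> x < b \<Longrightarrow> x \<notin> set (jumps m)"
  shows "height T m b = height T m a"
  using assms
proof (induction b rule: dec_induct)
  case (step b)
  then have "b \<notin> set (jumps m)" by auto
  then have "height T m (Suc b) = height T m b" using step.prems height_mono_Suc[of b] by (auto simp: set_jumps)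
  then show ?case using step by simp
qed simp

lemma not_mem_gap:
  assumes "sorted_wrt (<) xs" "x \<in> set xs" "i < length xs" "x < xs ! i" "0 < i \<Longrightarrow> xs ! (i - 1) < (x::nat)"
  shows False
proof -
  obtain j where j: "j < length xs" "x = xs ! j" using assms(2) by (auto simp: in_set_conv_nth)
  have "j < i" using assms(1,3,4) j sorted_wrt_nth_less[OF assms(1), of i j] by (metis linorder_neqE_nat not_less_iff_gr_or_eq)
  moreover have "i - 1 < j" if "0 < i"
    using assms(1,3,5) j that sorted_wrt_nth_less[OF assms(1), of j "i - 1"]
    by (metis Suc_pred \<open>j < i\<close> less_imp_diff_less less_Suc_eq nat_neq_iff not_less_iff_gr_or_eq)
  ultimately show False by linarith
qed

lemma height_jump_nth:
  assumes "i < k"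
  shows "height T m (jumps m ! i) = (if i = 0 then m else height T m (Suc (jumps m ! (i - 1))))"
proof -
  define a where "a = (if i = 0 then 0 else Suc (jumps m ! (i - 1)))"
  have i: "i < length (jumps m)" using assms length_jumps_m by simp
  have "jumps m ! i < m" using nth_mem[OF i] by (simp add: set_jumps)
  moreover have "a \<le> jumps m ! i"
    using sorted_wrt_nth_less[OF sorted_jumps, of "i - 1" i] i by (auto simp: a_def)
  moreover have "x \<notin> set (jumps m)" if "a \<le> x" "x < jumps m ! i" for x
    using not_mem_gap[OF sorted_jumps _ i that(2)] that(1) by (auto simp: a_def split: if_splits)
  ultimately have "height T m (jumps m ! i) = height T m a" by (intro height_const) auto
  then show ?thesis by (auto simp: a_def height_0)
qed

lemma height_last_jump:
  assumes "0 < k"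
  shows "height T m m = height T m (Suc (jumps m ! (k - 1)))"
proof (rule height_const)
  have i: "k - 1 < length (jumps m)" using assms length_jumps_m by simp
  show "Suc (jumps m ! (k - 1)) \<le> m" using nth_mem[OF i] by (simp add: set_jumps)
  fix x assume x: "Suc (jumps m ! (k - 1)) \<le> x"
  show "x \<notin> set (jumps m)"
  proof
    assume "x \<in> set (jumps m)"
    then obtain j where j: "j < length (jumps m)" "x = jumps m ! j" by (auto simp: in_set_conv_nth)
    show False
    proof (cases "j = k - 1")
      case False
      then have "j < k - 1" using j length_jumps_m by simp
      then show False using sorted_wrt_nth_less[OF sorted_jumps _ i, of j] x j by simp
    qed (use x j in simp)
  qed
qed simp

text \<open>The columns of the vertical stretches, then \<open>m\<close>, which is both the first
  row and the last column, then the rows at the upper ends of these stretches.\<close>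

definition pipe_star :: "nat list" where
  "pipe_star = jumps m @ m # map (\<lambda>x. height T m (Suc x)) (jumps m)"

lemma pipe_star_nth:
  "i < k \<Longrightarrow> pipe_star ! i = jumps m ! i"
  "pipe_star ! k = m"
  "i < k \<Longrightarrow> pipe_star ! Suc (k + i) = height T m (Suc (jumps m ! i))"
  "i < k \<Longrightarrow> pipe_star ! (k + i) = height T m (jumps m ! i)"
proof -
  show 1: "i < k \<Longrightarrow> pipe_star ! i = jumps m ! i" "pipe_star ! k = m"
    "i < k \<Longrightarrow> pipe_star ! Suc (k + i) = height T m (Suc (jumps m ! i))" for i
    using length_jumps_m by (simp_all add: pipe_star_def nth_append)
  show "i < k \<Longrightarrow> pipe_star ! (k + i) = height T m (jumps m ! i)"
    using height_jump_nth[of i] 1(2) 1(3)[of "i - 1"] by (cases i) auto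
qed

lemma star_vertices_pipe_star: "star_vertices n k pipe_star"
  unfolding star_vertices_def
proof (intro conjI)
  show "length pipe_star = 2 * k + 1" using length_jumps_m by (simp add: pipe_star_def)
  have gt: "m < height T m (Suc x)" if "x \<in> set (jumps m)" for x
    using that height_props(1)[of x] by (simp add: set_jumps)
  have mono: "height T m (Suc x) < height T m (Suc y)" if "x \<in> set (jumps m)" "y \<in> set (jumps m)" "x < y" for x y
    using that height_mono[of "Suc x" y] by (simp add: set_jumps)
  have "sorted_wrt (<) (map (\<lambda>x. height T m (Suc x)) (jumps m))"
    unfolding sorted_wrt_map using sorted_jumps mono by (rule sorted_wrt_mono_rel[rotated])
  then show "sorted_wrt (<) pipe_star"
    unfolding pipe_star_def using sorted_jumps gt
    by (fastforce simp: sorted_wrt_append set_jumps)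
  show "set pipe_star \<subseteq> {..<n}"
    using height_props(2) m by (auto simp: pipe_star_def set_jumps)
qed

lemma star_edges_pipe_star:
  assumes k: "0 < k"
  shows "star_edges k pipe_star \<subseteq> T"
proof -
  have mem: "jumps m ! i < m \<and> height T m (jumps m ! i) < height T m (Suc (jumps m ! i))" if "i < k" for i
    using nth_mem[of i "jumps m"] that length_jumps_m by (simp add: set_jumps)
  have "{pipe_star ! j, pipe_star ! ((j + k) mod (2 * k + 1))} \<in> T" if j: "j < 2 * k + 1" for j
  proof -
    \<comment> \<open>The star edges are the lower ends of the vertical stretches, the final cell in
      column \<open>m\<close>, and the upper ends.\<close>
    consider "j < k" | "j = k" | i where "j = Suc (k + i)" "i < k"
      using j by (metis add_Suc_right less_iff_Suc_add linorder_neqE_nat mult_2 Suc_eq_plus1 add_less_cancel_left not_less_eq)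
    then show ?thesis
    proof cases
      case 1
      then have "(j + k) mod (2 * k + 1) = k + j" by simp
      then show ?thesis using 1 height_jump(1)[of "jumps m ! j"] mem[of j]
        by (simp add: pipe_star_nth add.commute[of j k])
    next
      case 2
      have "pipe_star ! (2 * k) = height T m m"
        using pipe_star_nth(3)[of "k - 1"] height_last_jump k by (simp add: mult_2)
      moreover have "(j + k) mod (2 * k + 1) = 2 * k" using 2 by simp
      ultimately show ?thesis using 2 last_edge[OF k] by (simp add: pipe_star_nth mult_2)
    next
      case 3
      have "j + k = i + (2 * k + 1)" using 3 by simp
      then have "(j + k) mod (2 * k + 1) = i mod (2 * k + 1)" by (metis mod_add_self2)
      then have "(j + k) mod (2 * k + 1) = i" using 3 by simp
      then show ?thesis using 3 height_jump(2)[of "jumps m ! i"] mem[of i]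
        by (simp add: pipe_star_nth insert_commute)
    qed
  qed
  then show ?thesis by (auto simp: star_edges_def)
qed

text \<open>Both sides are the area below the staircase, cut into vertical strips between
  consecutive star vertices on the left and into single corners on the right.\<close>

lemma sum_star_area:
  assumes k: "0 < k"
  shows "(\<Sum>j = 1..k. (real (pipe_star ! j) - real (pipe_star ! (j - 1))) *
      (real (pipe_star ! (k + j)) - real (pipe_star ! k)))
    = real (\<Sum>X\<in>{1..n}. \<Sum>Y\<in>{1..n}. if X \<le> m \<and> m < Y then dlt T m X Y else 0)"
    (is "?l = ?r")
proof -
  define H where "H x = real (height T m x)" for x
  define a b where "a j = real (pipe_star ! j)" and "b j = real (pipe_star ! (k + j))" for j
  \<comment> \<open>Summation by parts passes to horizontal strips, one for each jump. Columns
    without a jump contribute 0, so all columns may be included, and a second summation by parts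
    returns to vertical strips, now of width one.\<close>
  have abel: "(\<Sum>j = 1..i. (a j - a (j - 1)) * (b j - b 0)) = (\<Sum>j = 1..i. (a i - a (j - 1)) * (b j - b (j - 1)))" for i
  proof (induction i)
    case (Suc i)
    have tel: "(\<Sum>j = 1..i. b j - b (j - 1)) = b i - b 0" for i
      by (induction i) auto
    have "(\<Sum>j = 1..Suc i. (a (Suc i) - a (j - 1)) * (b j - b (j - 1)))
      = (\<Sum>j = 1..Suc i. (a i - a (j - 1)) * (b j - b (j - 1)) + (a (Suc i) - a i) * (b j - b (j - 1)))"
      by (intro sum.cong) (auto simp: algebra_simps)
    also have "\<dots> = (\<Sum>j = 1..i. (a i - a (j - 1)) * (b j - b (j - 1))) + (a (Suc i) - a i) * (b (Suc i) - b 0)"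
      by (simp only: sum.distrib sum_distrib_left[symmetric] tel) simp
    finally show ?case using Suc by simp
  qed simp
  have "?l = (\<Sum>j = 1..k. (a j - a (j - 1)) * (b j - b 0))" by (simp add: a_def b_def)
  also have "\<dots> = (\<Sum>j = 1..k. (a k - a (j - 1)) * (b j - b (j - 1)))" by (rule abel)
  also have "\<dots> = (\<Sum>i<k. (a k - a i) * (b (Suc i) - b i))"
    by (rule sum.reindex_bij_witness[of _ Suc "\<lambda>j. j - 1"]) auto
  also have "\<dots> = (\<Sum>i<k. (real m - real (jumps m ! i)) * (H (Suc (jumps m ! i)) - H (jumps m ! i)))"
    by (intro sum.cong) (auto simp: a_def b_def H_def pipe_star_nth)
  also have "\<dots> = (\<Sum>x\<leftarrow>jumps m. (real m - real x) * (H (Suc x) - H x))"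
    using length_jumps_m by (simp add: sum_list_sum_nth atLeast0LessThan)
  also have "\<dots> = (\<Sum>x\<in>set (jumps m). (real m - real x) * (H (Suc x) - H x))"
    by (intro sum_list_distinct_conv_sum_set) (simp add: jumps_def)
  also have "\<dots> = (\<Sum>x<m. (real m - real x) * (H (Suc x) - H x))"
    using height_mono_Suc by (intro sum.mono_neutral_left) (auto simp: set_jumps H_def nat_less_le)
  also have "\<dots> = (\<Sum>x<m. H (Suc x) - H 0)"
  proof -
    have "(\<Sum>x<i. (real i - real x) * (H (Suc x) - H x)) = (\<Sum>x<i. H (Suc x) - H 0)" for i
    proof (induction i)
      case (Suc i)
      have "(\<Sum>x<Suc i. (real (Suc i) - real x) * (H (Suc x) - H x))
        = (\<Sum>x<Suc i. (real i - real x) * (H (Suc x) - H x) + (H (Suc x) - H x))"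
        by (intro sum.cong) (auto simp: algebra_simps)
      also have "\<dots> = (\<Sum>x<i. (real i - real x) * (H (Suc x) - H x)) + (H (Suc i) - H 0)"
        by (simp only: sum.distrib sum_lessThan_telescope) simp
      finally show ?case using Suc by simp
    qed simp
    then show ?thesis .
  qed
  also have "\<dots> = real (\<Sum>X\<in>{1..m}. height T m X - m)"
    unfolding of_nat_sum using height_props(1) height_0
    by (intro sum.reindex_bij_witness[of _ "\<lambda>x. x - 1" Suc]) (auto simp: H_def of_nat_diff)
  also have "(\<Sum>X\<in>{1..m}. height T m X - m) = (\<Sum>X\<in>{1..m}. \<Sum>Y\<in>{1..n}. if m < Y then dlt T m X Y else 0)"
  proof (rule sum.cong[OF refl])
    fix X assume "X \<in> {1..m}"
    then have X: "X \<le> m" by simp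
    have "(\<Sum>Y\<in>{1..n}. if m < Y then dlt T m X Y else 0) = (\<Sum>Y\<in>{Suc m..height T m X}. 1)"
      using dlt_height[OF X] height_props(2)[OF X] by (intro sum.mono_neutral_cong_right) auto
    then show "height T m X - m = (\<Sum>Y\<in>{1..n}. if m < Y then dlt T m X Y else 0)" by simp
  qed
  also have "\<dots> = (\<Sum>X\<in>{1..n}. \<Sum>Y\<in>{1..n}. if X \<le> m \<and> m < Y then dlt T m X Y else 0)"
    using m by (intro sum.mono_neutral_cong_left) auto
  finally show ?thesis .
qed

end

section \<open>Uniqueness of the star with a given middle vertex\<close>

lemma star_edges_D:
  assumes "star_edges k s \<subseteq> T"
  shows "i \<le> k \<Longrightarrow> {s ! i, s ! (k + i)} \<in> T" "i < k \<Longrightarrow> {s ! i, s ! Suc (k + i)} \<in> T"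
proof -
  have *: "{s ! j, s ! ((j + k) mod (2 * k + 1))} \<in> T" if "j < 2 * k + 1" for j
    using assms that unfolding star_edges_def by blast
  show "{s ! i, s ! (k + i)} \<in> T" if "i \<le> k"
    using *[of i] that by (simp add: add.commute[of i k])
  show "{s ! i, s ! Suc (k + i)} \<in> T" if "i < k"
  proof -
    have "Suc (k + i) + k = i + (2 * k + 1)" by simp
    then have "(Suc (k + i) + k) mod (2 * k + 1) = i mod (2 * k + 1)" by (metis mod_add_self2)
    then show ?thesis using *[of "Suc (k + i)"] that by (simp add: insert_commute)
  qed
qed

context
  fixes n k :: nat and T :: "nat set set" and s :: "nat list"
  assumes cf: "crossing_free n (k + 1) T" and T: "T \<subseteq> edges n"
    and s: "star_vertices n k s" "star_edges k s \<subseteq> T"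
begin

lemma star_less: "i < j \<Longrightarrow> j \<le> 2 * k \<Longrightarrow> s ! i < s ! j"
  using s(1) sorted_wrt_nth_less[of "(<)" s i j] by (simp add: star_vertices_def)

lemma star_mono: "i \<le> j \<Longrightarrow> j \<le> 2 * k \<Longrightarrow> s ! i \<le> s ! j"
  using star_less[of i j] by (cases "i = j") auto

text \<open>An edge of \<open>T\<close> meeting a straight stretch of the staircase of a star could be inserted between
  edges of the star to form a \<open>(k + 1)\<close>-crossing. So a star is determined by its middle vertex.\<close>

lemma star_no_left:
  assumes "a < s ! 0" "{a, s ! k} \<in> T"
  shows False
proof -
  let ?us = "(a, s ! k) # map (\<lambda>i. (s ! i, s ! Suc (k + i))) [0..<k]"
  have "length ?us \<le> k"
  proof (rule chain_length_le[OF cf T, of _ "s ! k"])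
    have "chain (map (\<lambda>i. (s ! i, s ! Suc (k + i))) [0..<k])"
      by (rule chain_map_upt; use star_less in simp)
    moreover have "a < s ! i" if "i \<le> k" for i
      using star_mono[of 0 i] that assms(1) by simp
    ultimately show "chain ?us"
      using star_less by (auto simp: chain_Cons)
    have "a < s ! k" using star_mono[of 0 k] assms(1) by simp
    then show "\<forall>u\<in>set ?us. cell_edge u \<in> T \<and> fst u < s ! k \<and> s ! k \<le> snd u"
      using assms(2) star_edges_D[OF s(2)] star_less
      by (auto simp: cell_edge_def intro!: star_mono)
  qed
  then show False by simp
qed

lemma star_no_vertical:
  assumes "j < k" "s ! (k + j) < b" "b < s ! Suc (k + j)" "{s ! j, b} \<in> T"
  shows False
proof -
  \<comment> \<open>Upper ends of the earlier vertical stretches, the new cell, lower ends of the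
    later ones: \<open>k + 1\<close> cells. The last group contains the cell in column
    \<open>s ! k\<close>, hence the bound \<open>Suc (s ! k)\<close>.\<close>
  let ?E = "map (\<lambda>i. (s ! i, s ! Suc (k + i))) [0..<j]" and ?C = "map (\<lambda>i. (s ! i, s ! (k + i))) [Suc j..<Suc k]"
  have "length (?E @ (s ! j, b) # ?C) \<le> k"
  proof (rule chain_length_le[OF cf T, of _ "Suc (s ! k)"])
    have "chain ?E" "chain ?C" by (rule chain_map_upt; use star_less assms(1) in simp)+
    moreover have "s ! Suc (k + i) < b" if "i < j" for i
      using star_mono[of "Suc (k + i)" "k + j"] that assms by simp
    moreover have "b < s ! (k + i)" if "j < i" "i \<le> k" for i
      using star_mono[of "Suc (k + j)" "k + i"] that assms by simp
    moreover have "s ! Suc (k + i) < s ! (k + i')" if "i < j" "j < i'" "i' \<le> k" for i i'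
      using star_less[of "Suc (k + i)" "k + i'"] that by simp
    ultimately show "chain (?E @ (s ! j, b) # ?C)"
      using star_less assms(1) unfolding chain_append chain_Cons by (auto simp: less_Suc_eq_le)
    have "s ! k < b" using assms star_mono[of k "k + j"] by simp
    then show "\<forall>u\<in>set (?E @ (s ! j, b) # ?C). cell_edge u \<in> T \<and> fst u < Suc (s ! k) \<and> Suc (s ! k) \<le> snd u"
      using assms(1,4) star_edges_D[OF s(2)] star_less
      by (auto simp: cell_edge_def less_Suc_eq_le Suc_le_eq intro!: star_mono)
  qed
  then show False using assms(1) by simp
qed

lemma star_no_horizontal:
  assumes "j < k" "s ! j < a" "a < s ! Suc j" "{a, s ! Suc (k + j)} \<in> T"
  shows False
proof -
  \<comment> \<open>Here lower ends come first and upper ends last. The first cell has row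
    \<open>s ! k\<close>, hence the bound \<open>s ! k\<close>.\<close>
  let ?C = "map (\<lambda>i. (s ! i, s ! (k + i))) [0..<Suc j]" and ?E = "map (\<lambda>i. (s ! i, s ! Suc (k + i))) [Suc j..<k]"
  have "length (?C @ (a, s ! Suc (k + j)) # ?E) \<le> k"
  proof (rule chain_length_le[OF cf T, of _ "s ! k"])
    have "chain ?E" "chain ?C" by (rule chain_map_upt; use star_less assms(1) in simp)+
    moreover have "s ! i < a" if "i \<le> j" for i
      using star_mono[of i j] that assms by simp
    moreover have "a < s ! i" if "j < i" "i < k" for i
      using star_mono[of "Suc j" i] that assms by simp
    moreover have "s ! (k + i) < s ! Suc (k + i')" if "i \<le> i'" "i' < k" for i i'
      using star_less[of "k + i" "Suc (k + i')"] that by simp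
    ultimately show "chain (?C @ (a, s ! Suc (k + j)) # ?E)"
      using star_less assms(1) unfolding chain_append chain_Cons by (auto simp: less_Suc_eq_le)
    have "a < s ! k" using assms star_mono[of "Suc j" k] by simp
    then show "\<forall>u\<in>set (?C @ (a, s ! Suc (k + j)) # ?E). cell_edge u \<in> T \<and> fst u < s ! k \<and> s ! k \<le> snd u"
      using assms(1,4) star_edges_D[OF s(2)] star_less
      by (auto simp: cell_edge_def less_Suc_eq_le Suc_le_eq intro!: star_mono)
  qed
  then show False using assms(1) by simp
qed

end

lemma star_unique:
  assumes k: "0 < k" and cf: "crossing_free n (k + 1) T" and T: "T \<subseteq> edges n"
    and s: "star_vertices n k s" "star_edges k s \<subseteq> T"
    and t: "star_vertices n k t" "star_edges k t \<subseteq> T" and eq: "s ! k = t ! k"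
  shows "s = t"
proof -
  have "\<not> s ! 0 < t ! 0" "\<not> t ! 0 < s ! 0"
    using star_no_left[OF cf T t, of "s ! 0"] star_no_left[OF cf T s, of "t ! 0"]
      star_edges_D(1)[OF s(2), of 0] star_edges_D(1)[OF t(2), of 0] eq by auto
  then have base: "s ! 0 = t ! 0" by simp
  \<comment> \<open>The two staircases are followed together: first up the vertical stretch in
    column \<open>s ! j\<close>, then along the horizontal stretch that follows it.\<close>
  have main: "s ! j = t ! j \<and> s ! (k + j) = t ! (k + j)" if "j \<le> k" for j
    using that
  proof (induction j)
    case (Suc j)
    then have IH: "s ! j = t ! j" "s ! (k + j) = t ! (k + j)" and j: "j < k" by auto
    have "\<not> s ! Suc (k + j) < t ! Suc (k + j)" "\<not> t ! Suc (k + j) < s ! Suc (k + j)"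
      using star_no_vertical[OF cf T t j, of "s ! Suc (k + j)"] star_no_vertical[OF cf T s j, of "t ! Suc (k + j)"]
        star_edges_D(2)[OF s(2) j] star_edges_D(2)[OF t(2) j] IH j
        star_less[OF cf T s, of "k + j" "Suc (k + j)"] star_less[OF cf T t, of "k + j" "Suc (k + j)"] by auto
    then have 1: "s ! Suc (k + j) = t ! Suc (k + j)" by simp
    have "\<not> s ! Suc j < t ! Suc j" "\<not> t ! Suc j < s ! Suc j"
      using star_no_horizontal[OF cf T t j, of "s ! Suc j"] star_no_horizontal[OF cf T s j, of "t ! Suc j"]
        star_edges_D(1)[OF s(2), of "Suc j"] star_edges_D(1)[OF t(2), of "Suc j"] IH j 1
        star_less[OF cf T s, of j "Suc j"] star_less[OF cf T t, of j "Suc j"] by auto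
    then show ?case using 1 by simp
  qed (use base eq in simp)
  show ?thesis
  proof (rule nth_equalityI)
    show "length s = length t" using s t by (simp add: star_vertices_def)
    fix i assume "i < length s"
    then have "i < 2 * k + 1" using s by (simp add: star_vertices_def)
    then show "s ! i = t ! i" using main[of i] main[of "i - k"] by (cases "i \<le> k") auto
  qed
qed

text \<open>The star numbered \<open>Suc m - k\<close> has middle vertex \<open>m\<close>; by
  existence and uniqueness it is \<open>pipe_star T m\<close>.\<close>

lemma beam_coord_eq:
  assumes k: "0 < k" and kt: "k_triangulation n k T" and n: "2 * k + 1 \<le> n" and m: "k \<le> m" "m < n - k"
  shows "beam_coord n k T (Suc m - k)
    = real (\<Sum>X\<in>{1..n}. \<Sum>Y\<in>{1..n}. if X \<le> m \<and> m < Y then dlt T m X Y else 0)"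
proof -
  have m': "k - 1 + (Suc m - k) = m" using k m by simp
  have "ith_star n k T (Suc m - k) = pipe_star T m"
    unfolding ith_star_def m'
  proof (rule the_equality)
    show "star_vertices n k (pipe_star T m) \<and> star_edges k (pipe_star T m) \<subseteq> T \<and> pipe_star T m ! k = m"
      using star_vertices_pipe_star[OF kt n m] star_edges_pipe_star[OF kt n m k] pipe_star_nth(2)[OF kt n m] by simp
    then show "s = pipe_star T m" if "star_vertices n k s \<and> star_edges k s \<subseteq> T \<and> s ! k = m" for s
      using that star_unique[OF k k_triangulationD(2,1)[OF kt], of s "pipe_star T m"] by auto
  qed
  then show ?thesis using sum_star_area[OF kt n m k] by (simp add: beam_coord_def Let_def)
qed

section \<open>Edges skipping k zeros\<close>

text \<open>The set \<open>D(\<sigma>)\<close>, as a function of the set \<open>Z\<close> of zero positions of \<open>0\<^sup>k\<sigma>0\<^sup>k\<close>.\<close>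

definition skip_edges :: "nat \<Rightarrow> nat set \<Rightarrow> nat set set" where
  "skip_edges k Z = {{sorted_list_of_set Z ! i, sorted_list_of_set Z ! (i + k)} | i. i + k < card Z}"

lemma sorted_list_nth_less_iff:
  assumes "finite Z" "i < card Z" "j < card Z"
  shows "sorted_list_of_set Z ! i < sorted_list_of_set Z ! j \<longleftrightarrow> i < (j::nat)"
proof -
  have "sorted_wrt (<) (sorted_list_of_set Z)" by simp
  then show ?thesis
    using sorted_wrt_nth_less[of "(<)" "sorted_list_of_set Z"] assms
    by (metis length_sorted_list_of_set less_asym linorder_neqE_nat nat_neq_iff)
qed

lemma sorted_list_nth_mem:
  assumes "finite Z" "i < card Z"
  shows "sorted_list_of_set Z ! i \<in> Z"
  using assms nth_mem[of i "sorted_list_of_set Z"] by simp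

text \<open>The bridge from list indices to counts: the indices of entries below \<open>c\<close>
  form an initial segment, as long as the number of such entries.\<close>

lemma sorted_list_nth_less:
  assumes Z: "finite (Z :: nat set)" "i < card Z"
  shows "sorted_list_of_set Z ! i < c \<longleftrightarrow> i < card (Z \<inter> {..<c})"
proof -
  let ?zs = "sorted_list_of_set Z"
  define S where "S = {j. j < card Z \<and> ?zs ! j < c}"
  have inj: "inj_on ((!) ?zs) S"
    unfolding S_def using sorted_list_nth_less_iff[OF Z(1)]
    by (intro inj_onI) (metis (no_types, lifting) mem_Collect_eq less_irrefl linorder_neqE_nat)
  have "(!) ?zs ` S = Z \<inter> {..<c}"
  proof
    show "(!) ?zs ` S \<subseteq> Z \<inter> {..<c}" using sorted_list_nth_mem[OF Z(1)] by (auto simp: S_def)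
    show "Z \<inter> {..<c} \<subseteq> (!) ?zs ` S"
    proof
      fix z assume z: "z \<in> Z \<inter> {..<c}"
      then have "z \<in> set ?zs" using Z by simp
      then obtain j where "j < length ?zs" "z = ?zs ! j" by (metis in_set_conv_nth)
      then show "z \<in> (!) ?zs ` S" using z by (auto simp: S_def)
    qed
  qed
  then have card: "card S = card (Z \<inter> {..<c})" using card_image[OF inj] by simp
  have fin: "finite S" by (simp add: S_def)
  show ?thesis
  proof
    assume less: "?zs ! i < c"
    have "{..i} \<subseteq> S"
    proof
      fix j assume "j \<in> {..i}"
      then have "?zs ! j \<le> ?zs ! i" using sorted_list_nth_less_iff[OF Z(1), of j i] Z(2) by (cases "j = i") auto
      then show "j \<in> S" using less \<open>j \<in> {..i}\<close> Z(2) by (auto simp: S_def)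
    qed
    from card_mono[OF fin this] show "i < card (Z \<inter> {..<c})" using card by simp
  next
    assume r: "i < card (Z \<inter> {..<c})"
    show "?zs ! i < c"
    proof (rule ccontr)
      assume ge: "\<not> ?zs ! i < c"
      have "S \<subseteq> {..<i}"
      proof
        fix j assume "j \<in> S"
        then have "?zs ! j < ?zs ! i" "j < card Z" using ge by (auto simp: S_def)
        then show "j \<in> {..<i}" using sorted_list_nth_less_iff[OF Z(1), of j i] Z(2) by simp
      qed
      from card_mono[OF _ this] show False using card r by simp
    qed
  qed
qed

lemma card_below_nth:
  assumes "finite (Z :: nat set)" "j < card Z"
  shows "card (Z \<inter> {..<sorted_list_of_set Z ! j}) = j"
proof -
  let ?r = "card (Z \<inter> {..<sorted_list_of_set Z ! j})"
  have "?r < card Z"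
    using sorted_list_nth_less[OF assms, of "sorted_list_of_set Z ! j"] assms by simp
  then have "\<not> ?r < j" using sorted_list_nth_less[OF assms(1), of ?r "sorted_list_of_set Z ! j"] 
    sorted_list_nth_less_iff[OF assms(1), of ?r j] assms by auto
  moreover have "\<not> j < ?r" using sorted_list_nth_less[OF assms, of "sorted_list_of_set Z ! j"] by simp
  ultimately show ?thesis by simp
qed

section \<open>Counting zeros in intervals\<close>

definition cnt :: "nat set \<Rightarrow> nat \<Rightarrow> nat \<Rightarrow> nat" where
  "cnt Z X Y = card (Z \<inter> {X..<Y})"

lemma cnt_below: "X \<le> Y \<Longrightarrow> card (Z \<inter> {..<Y}) = card (Z \<inter> {..<X}) + cnt Z X Y"
proof -
  assume "X \<le> Y"
  then have "Z \<inter> {..<Y} = (Z \<inter> {..<X}) \<union> (Z \<inter> {X..<Y})" by auto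
  moreover have "(Z \<inter> {..<X}) \<inter> (Z \<inter> {X..<Y}) = {}" by auto
  ultimately show ?thesis unfolding cnt_def
    by (metis card_Un_disjoint finite_Int finite_atLeastLessThan finite_lessThan)
qed

lemma cnt_empty [simp]: "Y \<le> X \<Longrightarrow> cnt Z X Y = 0"
  by (simp add: cnt_def)

lemma cnt_Suc_right: "X \<le> Y \<Longrightarrow> cnt Z X (Suc Y) = cnt Z X Y + (if Y \<in> Z then 1 else 0)"
proof -
  assume "X \<le> Y"
  then have "Z \<inter> {X..<Suc Y} = (if Y \<in> Z then insert Y (Z \<inter> {X..<Y}) else Z \<inter> {X..<Y})"
    by (auto simp: less_Suc_eq)
  then show ?thesis by (simp add: cnt_def)
qed

lemma cnt_Suc_left: "X < Y \<Longrightarrow> cnt Z X Y = cnt Z (Suc X) Y + (if X \<in> Z then 1 else 0)"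
proof -
  assume "X < Y"
  then have "Z \<inter> {X..<Y} = (if X \<in> Z then insert X (Z \<inter> {Suc X..<Y}) else Z \<inter> {Suc X..<Y})"
    by (auto simp: Suc_le_eq order.order_iff_strict)
  then show ?thesis by (simp add: cnt_def)
qed

lemma cnt_mono: "X' \<le> X \<Longrightarrow> Y \<le> Y' \<Longrightarrow> cnt Z X Y \<le> cnt Z X' Y'"
  unfolding cnt_def by (intro card_mono) auto

lemma cnt_ge: "{a..<b} \<subseteq> Z \<Longrightarrow> X \<le> a \<Longrightarrow> b \<le> Y \<Longrightarrow> b - a \<le> cnt Z X Y"
proof -
  assume *: "{a..<b} \<subseteq> Z" "X \<le> a" "b \<le> Y"
  have "card {a..<b} \<le> cnt Z X Y"
    unfolding cnt_def by (rule card_mono) (use * in auto)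
  then show ?thesis by simp
qed

lemma nat_intermediate:
  fixes f :: "nat \<Rightarrow> nat"
  assumes "a \<le> b" "\<And>i. a \<le> i \<Longrightarrow> i < b \<Longrightarrow> f (Suc i) \<le> Suc (f i)" "f a \<le> v" "v \<le> f b"
  shows "\<exists>i. a \<le> i \<and> i \<le> b \<and> f i = v"
  using assms
proof (induction b rule: dec_induct)
  case (step b)
  show ?case
  proof (cases "v \<le> f b")
    case True
    then show ?thesis using step.IH step.prems by fastforce
  next
    case False
    then have "f (Suc b) = v" using step.prems(1)[of b] step.hyps step.prems(3) by simp
    then show ?thesis using step.hyps by (intro exI[of _ "Suc b"]) simp
  qed
qed auto

lemma nat_intermediate_down:
  fixes f :: "nat \<Rightarrow> nat"
  assumes "a \<le> b" "\<And>i. a \<le> i \<Longrightarrow> i < b \<Longrightarrow> f i \<le> Suc (f (Suc i))" "v \<le> f a" "f b \<le> v"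
  shows "\<exists>i. a \<le> i \<and> i \<le> b \<and> f i = v"
proof -
  have "\<exists>i. 0 \<le> i \<and> i \<le> b - a \<and> f (b - i) = v"
  proof (rule nat_intermediate)
    fix i assume "i < b - a"
    then show "f (b - Suc i) \<le> Suc (f (b - i))"
      using assms(2)[of "b - Suc i"] by (simp add: Suc_diff_Suc)
  qed (use assms in auto)
  then show ?thesis using assms(1) by (metis diff_le_self le_diff_conv2 le_diff_conv diff_diff_cancel diff_le_mono2)
qed

text \<open>These are the sets of zero positions of words \<open>0\<^sup>k\<sigma>0\<^sup>k\<close>
  of length \<open>n\<close>.\<close>

definition bordered :: "nat \<Rightarrow> nat \<Rightarrow> nat set \<Rightarrow> bool" where
  "bordered n k Z \<longleftrightarrow> {..<k} \<subseteq> Z \<and> {n - k..<n} \<subseteq> Z \<and> Z \<subseteq> {..<n}"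

lemma bordered_finite: "bordered n k Z \<Longrightarrow> finite Z"
  unfolding bordered_def using finite_subset by blast

context
  fixes n k :: nat
  assumes k: "0 < k" and n: "2 * k + 1 \<le> n"
begin

text \<open>A longest chain cannot be longer, since it could be prolonged by the edges of \<open>D(\<sigma>)\<close> leaving
  \<open>Z \<inter> {X..<c}\<close>; and the edges of \<open>D(\<sigma>)\<close> entering \<open>Z \<inter> {c..<Y}\<close> form a chain of this length.\<close>

lemma lpp_skip:
  assumes kt: "k_triangulation n k T" and Z: "bordered n k Z" and sub: "skip_edges k Z \<subseteq> T"
    and XY: "cnt Z X Y = k" "Y \<le> n" and c: "k \<le> c" "X \<le> c" "c \<le> n - k" "c \<le> Y"
  shows "lpp T c X Y = cnt Z c Y"
proof -
  let ?zs = "sorted_list_of_set Z"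
  define r where "r c = card (Z \<inter> {..<c})" for c
  note fin = bordered_finite[OF Z]
  note less = sorted_list_nth_less[OF fin, folded r_def]
  note mono = sorted_list_nth_less_iff[OF fin]
  have rY: "r Y = r X + k" using cnt_below[of X Y Z] XY c by (simp add: r_def)
  have rc: "r Y = r c + cnt Z c Y" "r c = r X + cnt Z X c"
    using cnt_below[of c Y Z] cnt_below[of X c Z] c by (auto simp: r_def)
  have r_le: "r a \<le> card Z" for a unfolding r_def using fin by (intro card_mono) auto
  \<comment> \<open>The padding on the left gives each zero from \<open>c\<close> on a
    \<open>k\<close>-th predecessor; the padding on the right (\<open>cZ\<close>) gives each zero
    below \<open>c\<close> a \<open>k\<close>-th successor.\<close>
  have kc: "k \<le> r c"
  proof -
    have "card {..<k} \<le> r c" unfolding r_def by (rule card_mono) (use Z c in \<open>auto simp: bordered_def\<close>)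
    then show ?thesis by simp
  qed
  have cZ: "r c + k \<le> card Z"
  proof -
    have "r c + card {n - k..<n} = card ((Z \<inter> {..<c}) \<union> {n - k..<n})"
      unfolding r_def by (rule card_Un_disjoint[symmetric]) (use fin c in auto)
    also have "\<dots> \<le> card Z" by (rule card_mono) (use Z fin in \<open>auto simp: bordered_def\<close>)
    finally show ?thesis using n by simp
  qed
  have edge: "{?zs ! i, ?zs ! (i + k)} \<in> T" if "i + k < card Z" for i
    using sub that unfolding skip_edges_def by blast
  show ?thesis
  proof (rule antisym)
    let ?ws = "map (\<lambda>i. (?zs ! i, ?zs ! (i + k))) [r X..<r c]"
    obtain us where us: "chain us" "set us \<subseteq> box T c X Y" "length us = lpp T c X Y" by (rule lpp_attained)
    have ws: "X \<le> ?zs ! i \<and> ?zs ! i < c \<and> Y \<le> ?zs ! (i + k) \<and> {?zs ! i, ?zs ! (i + k)} \<in> T"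
      if "r X \<le> i" "i < r c" for i
      using that cZ less[of i X] less[of i c] less[of "i + k" Y] rY edge[of i] by auto
    have "chain ?ws" by (rule chain_map_upt) (use mono cZ in simp)
    then have "chain (us @ ?ws)" unfolding chain_append using us(1,2) ws by (fastforce simp: box_def)
    moreover have "\<forall>u\<in>set (us @ ?ws). cell_edge u \<in> T \<and> fst u < c \<and> c \<le> snd u"
      using us(2) ws c by (fastforce simp: box_def cell_edge_def)
    ultimately have "length (us @ ?ws) \<le> k"
      by (rule chain_length_le[OF k_triangulationD(2,1)[OF kt]])
    then show "lpp T c X Y \<le> cnt Z c Y" using us(3) rc rY by simp
  next
    let ?ws = "map (\<lambda>i. (?zs ! (i - k), ?zs ! i)) [r c..<r Y]"
    have "length ?ws \<le> lpp T c X Y"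
    proof (rule chain_le_lpp)
      show "chain ?ws"
        by (rule chain_map_upt) (use mono kc r_le[of Y] in \<open>simp add: diff_less_mono\<close>)
      have "{?zs ! (i - k), ?zs ! i} \<in> T \<and> ?zs ! (i - k) < X \<and> c \<le> ?zs ! i \<and> ?zs ! i < Y"
        if "r c \<le> i" "i < r Y" for i
        using that kc r_le[of Y] less[of "i - k" X] less[of i c] less[of i Y] rY edge[of "i - k"] by auto
      then show "set ?ws \<subseteq> box T c X Y" by (auto simp: box_def cell_edge_def)
    qed
    then show "cnt Z c Y \<le> lpp T c X Y" using rc by simp
  qed
qed

lemma dlt_skip:
  assumes kt: "k_triangulation n k T" and Z: "bordered n k Z" and sub: "skip_edges k Z \<subseteq> T"
    and XY: "cnt Z X Y = k" "Y \<le> n" and m: "k \<le> m" "m < n - k" "X \<le> m" "m < Y"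
  shows "dlt T m X Y = (if m \<in> Z then 1 else 0)"
  using lpp_skip[OF kt Z sub XY, of m] lpp_skip[OF kt Z sub XY, of "Suc m"] m cnt_Suc_left[of m Y Z]
  by (simp add: dlt_def)

text \<open>Shrinking the interval around \<open>m\<close> until it has exactly \<open>k\<close>
  zeros can only increase \<open>dlt\<close>, and there \<open>dlt_skip\<close> gives 0.\<close>

lemma dlt_skip_one:
  assumes kt: "k_triangulation n k T" and Z: "bordered n k Z" and sub: "skip_edges k Z \<subseteq> T"
    and XY: "k \<le> cnt Z X Y" "Y \<le> n" and m: "k \<le> m" "m < n - k" "X \<le> m" "m < Y" and mZ: "m \<notin> Z"
  shows "dlt T m X Y = 0"
proof -
  have "\<exists>X' Y'. X \<le> X' \<and> X' \<le> m \<and> m < Y' \<and> Y' \<le> Y \<and> cnt Z X' Y' = k"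
  proof (cases "cnt Z X (Suc m) \<le> k")
    case True
    have "\<exists>Y'. Suc m \<le> Y' \<and> Y' \<le> Y \<and> cnt Z X Y' = k"
      by (rule nat_intermediate) (use True XY m cnt_Suc_right[of X _ Z] in auto)
    then show ?thesis using m by (metis Suc_le_eq order_refl)
  next
    case False
    have "\<exists>X'. X \<le> X' \<and> X' \<le> m \<and> cnt Z X' (Suc m) = k"
      by (rule nat_intermediate_down)
        (use False m mZ cnt_Suc_left[of _ "Suc m" Z] cnt_Suc_right[of m m Z] in auto)
    then show ?thesis using m by (metis Suc_le_eq lessI)
  qed
  then obtain X' Y' where *: "X \<le> X'" "X' \<le> m" "m < Y'" "Y' \<le> Y" "cnt Z X' Y' = k" by blast
  have "dlt T m X Y \<le> dlt T m X' Y" using * by (intro dlt_mono_col)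
  also have "\<dots> \<le> dlt T m X' Y'" using * by (intro dlt_antimono_row)
  also have "\<dots> = 0" using dlt_skip[OF kt Z sub *(5)] * m XY mZ by simp
  finally show ?thesis by simp
qed

text \<open>Raising \<open>Y\<close> until there are exactly \<open>k\<close> zeros can only
  decrease \<open>dlt\<close>, and there \<open>dlt_skip\<close> gives 1. The padding on the right
  supplies enough zeros.\<close>

lemma dlt_skip_zero:
  assumes kt: "k_triangulation n k T" and Z: "bordered n k Z" and sub: "skip_edges k Z \<subseteq> T"
    and XY: "cnt Z X Y \<le> k" "Y \<le> n" and m: "k \<le> m" "m < n - k" "X \<le> m" "m < Y" and mZ: "m \<in> Z"
  shows "dlt T m X Y = 1"
proof -
  have "k \<le> cnt Z X n"
    using cnt_ge[of "n - k" n Z X n] Z m n by (simp add: bordered_def)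
  then have "\<exists>Y'. Y \<le> Y' \<and> Y' \<le> n \<and> cnt Z X Y' = k"
    by (intro nat_intermediate) (use XY m cnt_Suc_right[of X _ Z] in auto)
  then obtain Y' where *: "Y \<le> Y'" "Y' \<le> n" "cnt Z X Y' = k" by blast
  have "1 = dlt T m X Y'" using dlt_skip[OF kt Z sub *(3,2)] m mZ * by simp
  also have "\<dots> \<le> dlt T m X Y" using * m by (intro dlt_antimono_row)
  finally show ?thesis using dlt_le_1[of T m X Y] by simp
qed

section \<open>The lower bound for the functional and its equality case\<close>

abbreviation Mid :: "nat set" where "Mid \<equiv> {k..<n - k}"

definition brick_total :: "nat set set \<Rightarrow> nat \<Rightarrow> nat \<Rightarrow> nat" where
  "brick_total T X Y = (\<Sum>m\<in>Mid \<inter> {X..<Y}. dlt T m X Y)"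

lemma lpp_upper_indep:
  assumes "k_triangulation n k T" "k_triangulation n k T'" "Y \<le> n"
  shows "lpp T (min (n - k) Y) X Y = lpp T' (min (n - k) Y) X Y"
  using lpp_top[OF assms(1) n, of "n - k" Y X] lpp_top[OF assms(2) n, of "n - k" Y X] assms(3)
  by (auto simp: min_def)

text \<open>The sum telescopes to a difference of two values of \<open>lpp\<close>, for the bounds
  \<open>max k X\<close> and \<open>min (n - k) Y\<close>, and these are fixed by the short and the
  long edges.\<close>

lemma brick_total_indep:
  assumes kt: "k_triangulation n k T" "k_triangulation n k T'" and Y: "Y \<le> n"
  shows "brick_total T X Y = brick_total T' X Y"
proof -
  define c d where "c = max k X" and "d = min (n - k) Y"
  have Mid: "Mid \<inter> {X..<Y} = {c..<d}" by (auto simp: c_def d_def)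
  have "lpp T c X Y = lpp T' c X Y"
    using lpp_bottom[OF kt(1), of X c Y] lpp_bottom[OF kt(2), of X c Y] Y by (simp add: c_def max.commute)
  moreover have "lpp T d X Y = lpp T' d X Y"
    unfolding d_def by (rule lpp_upper_indep[OF kt Y])
  ultimately show ?thesis
    unfolding brick_total_def Mid using sum_dlt[of c d T X Y] sum_dlt[of c d T' X Y]
    by (cases "c \<le> d") simp_all
qed

lemma brick_total_split:
  "brick_total T X Y = (\<Sum>m\<in>(Mid - Z) \<inter> {X..<Y}. dlt T m X Y) + (\<Sum>m\<in>Z \<inter> Mid \<inter> {X..<Y}. dlt T m X Y)"
proof -
  have "Mid \<inter> {X..<Y} = ((Mid - Z) \<inter> {X..<Y}) \<union> (Z \<inter> Mid \<inter> {X..<Y})" by auto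
  moreover have "((Mid - Z) \<inter> {X..<Y}) \<inter> (Z \<inter> Mid \<inter> {X..<Y}) = {}" by auto
  ultimately show ?thesis unfolding brick_total_def
    by (metis (no_types, lifting) sum.union_disjoint finite_Int finite_atLeastLessThan)
qed

lemma sum_dlt_le_card: "(\<Sum>m\<in>A. dlt T m X Y) \<le> card A"
  using sum_mono[of A "\<lambda>m. dlt T m X Y" "\<lambda>_. 1"] dlt_le_1 by simp

text \<open>The staircase of each zero contributes at most one, so those of the ones must supply the
  rest of the total.\<close>

lemma sum_dlt_lower:
  "brick_total T X Y - card (Z \<inter> Mid \<inter> {X..<Y}) \<le> (\<Sum>m\<in>(Mid - Z) \<inter> {X..<Y}. dlt T m X Y)"
  using brick_total_split[of T X Y Z] sum_dlt_le_card[of T X Y "Z \<inter> Mid \<inter> {X..<Y}"] by simp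

text \<open>With at least \<open>k\<close> zeros in the interval no staircase of a one contributes;
  with fewer, every staircase of a zero does. Either way the bound is sharp.\<close>

lemma sum_dlt_skip:
  assumes kt: "k_triangulation n k T" and Z: "bordered n k Z" and sub: "skip_edges k Z \<subseteq> T" and Y: "Y \<le> n"
  shows "(\<Sum>m\<in>(Mid - Z) \<inter> {X..<Y}. dlt T m X Y) = brick_total T X Y - card (Z \<inter> Mid \<inter> {X..<Y})"
proof (cases "k \<le> cnt Z X Y")
  case True
  then have "(\<Sum>m\<in>(Mid - Z) \<inter> {X..<Y}. dlt T m X Y) = 0"
    using dlt_skip_one[OF kt Z sub True Y] by (intro sum.neutral) auto
  then show ?thesis using sum_dlt_lower[of T X Y Z] by simp
next
  case False
  then have "(\<Sum>m\<in>Z \<inter> Mid \<inter> {X..<Y}. dlt T m X Y) = (\<Sum>m\<in>Z \<inter> Mid \<inter> {X..<Y}. 1)"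
    using dlt_skip_zero[OF kt Z sub _ Y, of X] by (intro sum.cong) auto
  then show ?thesis using brick_total_split[of T X Y Z] by simp
qed

lemma brick_total_skip:
  assumes kt: "k_triangulation n k T" and Z: "bordered n k Z" and sub: "skip_edges k Z \<subseteq> T"
    and XY: "cnt Z X Y = k" "Y \<le> n"
  shows "brick_total T X Y = card (Z \<inter> Mid \<inter> {X..<Y})"
proof -
  have "(\<Sum>m\<in>(Mid - Z) \<inter> {X..<Y}. dlt T m X Y) = 0"
    using dlt_skip[OF kt Z sub XY] by (intro sum.neutral) auto
  moreover have "(\<Sum>m\<in>Z \<inter> Mid \<inter> {X..<Y}. dlt T m X Y) = (\<Sum>m\<in>Z \<inter> Mid \<inter> {X..<Y}. 1)"
    using dlt_skip[OF kt Z sub XY] by (intro sum.cong) auto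
  ultimately show ?thesis using brick_total_split[of T X Y Z] by simp
qed

text \<open>The beam vector coordinate of middle vertex \<open>m\<close>, by
  \<open>psi_eq_beam_coord\<close>.\<close>

definition psi :: "nat set set \<Rightarrow> nat \<Rightarrow> nat" where
  "psi T m = (\<Sum>(X, Y)\<in>{1..n} \<times> {1..n}. if X \<le> m \<and> m < Y then dlt T m X Y else 0)"

text \<open>The truncated subtraction is intended: the summand is \<open>max 0 (total - zeros)\<close>.\<close>

definition least_cost :: "nat set set \<Rightarrow> nat set \<Rightarrow> nat" where
  "least_cost T Z = (\<Sum>(X, Y)\<in>{1..n} \<times> {1..n}. brick_total T X Y - card (Z \<inter> Mid \<inter> {X..<Y}))"

lemma sum_psi:
  assumes "finite U"
  shows "(\<Sum>m\<in>U. psi T m) = (\<Sum>(X, Y)\<in>{1..n} \<times> {1..n}. \<Sum>m\<in>U \<inter> {X..<Y}. dlt T m X Y)"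
proof -
  have "(\<Sum>m\<in>U. psi T m) = (\<Sum>p\<in>{1..n} \<times> {1..n}. \<Sum>m\<in>U. case p of (X, Y) \<Rightarrow> if X \<le> m \<and> m < Y then dlt T m X Y else 0)"
    unfolding psi_def by (rule sum.swap)
  also have "\<dots> = (\<Sum>(X, Y)\<in>{1..n} \<times> {1..n}. \<Sum>m\<in>U \<inter> {X..<Y}. dlt T m X Y)"
    using assms by (intro sum.cong) (auto simp: sum.inter_restrict[OF assms])
  finally show ?thesis .
qed

lemma least_cost_indep:
  assumes "k_triangulation n k T" "k_triangulation n k T'"
  shows "least_cost T Z = least_cost T' Z"
  unfolding least_cost_def using brick_total_indep[OF assms] by (intro sum.cong) auto

lemma least_cost_le: "least_cost T Z \<le> (\<Sum>m\<in>Mid - Z. psi T m)"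
  unfolding least_cost_def by (subst sum_psi) (auto intro!: sum_mono sum_dlt_lower)

lemma least_cost_attained:
  assumes kt: "k_triangulation n k T" and Z: "bordered n k Z" and sub: "skip_edges k Z \<subseteq> T"
  shows "(\<Sum>m\<in>Mid - Z. psi T m) = least_cost T Z"
  unfolding least_cost_def using sum_dlt_skip[OF kt Z sub] by (subst sum_psi) (auto intro!: sum.cong)

text \<open>Equality of the sums forces equality at each corner. Where the interval has exactly
  \<open>k\<close> zeros, the total equals the number of zeros in \<open>Mid\<close>, so each
  \<open>dlt\<close> is forced and agrees with that of \<open>T0\<close>.\<close>

lemma lpp_skip_of_attained:
  assumes kt: "k_triangulation n k T" "k_triangulation n k T0" and Z: "bordered n k Z" and sub: "skip_edges k Z \<subseteq> T0"
    and eq: "(\<Sum>m\<in>Mid - Z. psi T m) = least_cost T Z"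
    and XY: "cnt Z X Y = k" "Y \<le> n" and c: "k \<le> c" "X \<le> c" "c \<le> n - k" "c \<le> Y"
  shows "lpp T c X Y = cnt Z c Y"
proof -
  have "lpp T c X Y = lpp T0 c X Y"
  \<comment> \<open>Corners with \<open>X = 0\<close> do not occur in the sum, but
    \<open>lpp\<close> vanishes there.\<close>
  proof (cases "X = 0")
    case False
    have "(X, Y) \<in> {1..n} \<times> {1..n}" using False XY c k by (cases "Y = 0") auto
    moreover define g h where "g = (\<lambda>(X, Y). brick_total T X Y - card (Z \<inter> Mid \<inter> {X..<Y}))"
      and "h = (\<lambda>(X, Y). \<Sum>m\<in>(Mid - Z) \<inter> {X..<Y}. dlt T m X Y)"
    have "sum g ({1..n} \<times> {1..n}) = sum h ({1..n} \<times> {1..n})"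
      using eq sum_psi[of "Mid - Z" T] by (simp add: g_def h_def least_cost_def)
    moreover have "g p \<le> h p" for p
      using sum_dlt_lower by (cases p) (simp add: g_def h_def)
    ultimately have "g (X, Y) = h (X, Y)" using sum_mono_inv[of g _ h] by blast
    then have "(\<Sum>m\<in>(Mid - Z) \<inter> {X..<Y}. dlt T m X Y) = brick_total T X Y - card (Z \<inter> Mid \<inter> {X..<Y})"
      by (simp add: g_def h_def)
    moreover have tot: "brick_total T X Y = card (Z \<inter> Mid \<inter> {X..<Y})"
      using brick_total_skip[OF kt(2) Z sub XY] brick_total_indep[OF kt XY(2), of X] by simp
    ultimately have ones: "(\<Sum>m\<in>(Mid - Z) \<inter> {X..<Y}. dlt T m X Y) = 0" by simp
    then have zeros: "(\<Sum>m\<in>Z \<inter> Mid \<inter> {X..<Y}. dlt T m X Y) = (\<Sum>m\<in>Z \<inter> Mid \<inter> {X..<Y}. 1)"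
      using tot brick_total_split[of T X Y Z] by simp
    have pt: "dlt T m X Y = dlt T0 m X Y" if m: "k \<le> m" "m < n - k" "X \<le> m" "m < Y" for m
    proof (cases "m \<in> Z")
      case True
      have "dlt T m X Y = 1"
        by (rule sum_mono_inv[OF zeros]) (use dlt_le_1 True m in auto)
      then show ?thesis using dlt_skip[OF kt(2) Z sub XY m] True by simp
    next
      case False
      then have "dlt T m X Y = 0" using ones m by (subst (asm) sum_eq_0_iff) auto
      then show ?thesis using dlt_skip[OF kt(2) Z sub XY m] False by simp
    qed
    define d where "d = min (n - k) Y"
    have "c \<le> d" using c by (simp add: d_def)
    moreover have "(\<Sum>m\<in>{c..<d}. dlt T m X Y) = (\<Sum>m\<in>{c..<d}. dlt T0 m X Y)"
      using pt c by (intro sum.cong) (auto simp: d_def)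
    moreover have "lpp T d X Y = lpp T0 d X Y"
      unfolding d_def by (rule lpp_upper_indep[OF kt XY(2)])
    ultimately show ?thesis
      using sum_dlt[of c d T X Y] sum_dlt[of c d T0 X Y] by simp
  qed simp
  then show ?thesis using lpp_skip[OF kt(2) Z sub XY c] by simp
qed

text \<open>For a missing edge, some \<open>lpp T c\<close> would agree at \<open>(x, y)\<close> and
  \<open>(Suc x, Suc y)\<close>. Both intervals have exactly \<open>k\<close> zeros, so
  \<open>lpp\<close> counts the zeros from \<open>c\<close> on, and the second count includes one
  more zero, \<open>y\<close>.\<close>

lemma skip_edges_subset_of_attained:
  assumes kt: "k_triangulation n k T" "k_triangulation n k T0" and Z: "bordered n k Z" and sub: "skip_edges k Z \<subseteq> T0"
    and eq: "(\<Sum>m\<in>Mid - Z. psi T m) = least_cost T Z"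
  shows "skip_edges k Z \<subseteq> T"
proof
  let ?zs = "sorted_list_of_set Z"
  note fin = bordered_finite[OF Z]
  fix e assume "e \<in> skip_edges k Z"
  then obtain i where i: "e = {?zs ! i, ?zs ! (i + k)}" "i + k < card Z" by (auto simp: skip_edges_def)
  define x y where "x = ?zs ! i" and "y = ?zs ! (i + k)"
  have xy: "x < y" "y < n" "x \<in> Z" "y \<in> Z"
    using sorted_list_nth_less_iff[OF fin, of i "i + k"] sorted_list_nth_mem[OF fin, of i]
      sorted_list_nth_mem[OF fin, of "i + k"] i k Z by (auto simp: x_def y_def bordered_def)
  have cnt: "cnt Z x y = k"
    using cnt_below[of x y Z] card_below_nth[OF fin, of i] card_below_nth[OF fin, of "i + k"] i xy
    by (simp add: x_def y_def)
  then have cnt': "cnt Z (Suc x) (Suc y) = k"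
    using cnt_Suc_left[of x "Suc y" Z] cnt_Suc_right[of x y Z] xy by simp
  show "e \<in> T"
  proof (rule ccontr)
    assume "e \<notin> T"
    then have "{x, y} \<notin> T" using i by (simp add: x_def y_def)
    then obtain c where c: "x < c" "c \<le> y" "k < c" "c < n - k" "lpp T c (Suc x) (Suc y) = lpp T c x y"
      using missing_edge_lpp[OF kt(1) xy(1,2)] by metis
    then have "cnt Z c (Suc y) = cnt Z c y"
      using lpp_skip_of_attained[OF kt Z sub eq cnt, of c] lpp_skip_of_attained[OF kt Z sub eq cnt', of c] xy by simp
    then show False using cnt_Suc_right[OF c(2), of Z] xy by simp
  qed
qed

lemma psi_eq_beam_coord:
  assumes "k_triangulation n k T" "m \<in> Mid"
  shows "beam_coord n k T (Suc m - k) = real (psi T m)"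
  using beam_coord_eq[OF k assms(1) n, of m] assms(2) by (simp add: psi_def sum.cartesian_product)

end

section \<open>K-triangulations containing \<open>skip_edges\<close> for nested zero sets\<close>

lemma skip_edges_imp_subset:
  assumes "finite Z" "e \<in> skip_edges k Z"
  shows "e \<subseteq> Z"
proof -
  obtain i where "e = {sorted_list_of_set Z ! i, sorted_list_of_set Z ! (i + k)}" "i + k < card Z"
    using assms(2) by (auto simp: skip_edges_def)
  then show ?thesis
    using sorted_list_nth_mem[OF assms(1), of i] sorted_list_nth_mem[OF assms(1), of "i + k"] by simp
qed

lemma crosses_inner_endpoint:
  assumes "crosses {a, b} f" "a < b"
  obtains v where "v \<in> f" "a < v" "v < b"
proof -
  obtain p q r s where pq: "p < q" "q < r" "r < s"
    and "{a, b} = {p, r} \<and> f = {q, s} \<or> {a, b} = {q, s} \<and> f = {p, r}"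
    using assms(1) unfolding crosses_def by blast
  then consider "a = p" "b = r" "f = {q, s}" | "a = q" "b = s" "f = {p, r}"
    using assms(2) by (elim disjE conjE) (simp_all add: doubleton_eq_iff, linarith+)
  then show thesis
  proof cases
    case 1 then show thesis using that[of q] pq by simp
  next
    case 2 then show thesis using that[of r] pq by simp
  qed
qed

text \<open>In a \<open>(k + 1)\<close>-crossing, consider an edge that comes from the largest set \<open>Z\<close> involved. The other
  \<open>k\<close> edges have endpoints in \<open>Z\<close> strictly between its endpoints, where \<open>Z\<close> has only \<open>k - 1\<close> elements.\<close>

lemma crossing_free_Union_skip_edges:
  assumes k: "0 < k" and fin: "\<And>Z. Z \<in> A \<Longrightarrow> finite Z"
    and total: "\<And>Z Z'. Z \<in> A \<Longrightarrow> Z' \<in> A \<Longrightarrow> Z \<subseteq> Z' \<or> Z' \<subseteq> Z"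
  shows "crossing_free n (k + 1) (\<Union>Z\<in>A. skip_edges k Z)"
  unfolding crossing_free_def
proof
  assume "\<exists>X \<subseteq> \<Union>Z\<in>A. skip_edges k Z. is_crossing n (k + 1) X"
  then obtain X where X: "X \<subseteq> (\<Union>Z\<in>A. skip_edges k Z)" "card X = k + 1" "pairwise crosses X"
    by (auto simp: is_crossing_def)
  then have finX: "finite X" "X \<noteq> {}" using card_ge_0_finite[of X] by auto
  have "\<forall>e\<in>X. \<exists>Z. Z \<in> A \<and> e \<in> skip_edges k Z" using X(1) by blast
  then obtain lev where lev: "\<forall>e\<in>X. lev e \<in> A \<and> e \<in> skip_edges k (lev e)" by metis
  have "Max ((\<lambda>e. card (lev e)) ` X) \<in> (\<lambda>e. card (lev e)) ` X" using finX by (intro Max_in) auto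
  then obtain e where e: "e \<in> X" "Max ((\<lambda>e. card (lev e)) ` X) = card (lev e)" by auto
  have sub: "lev f \<subseteq> lev e" if "f \<in> X" for f
  proof -
    have "card (lev f) \<le> card (lev e)" unfolding e(2)[symmetric] using that finX by (intro Max_ge) auto
    then show ?thesis using total[of "lev f" "lev e"] lev that e(1) fin card_seteq by blast
  qed
  let ?Z = "lev e" and ?zs = "sorted_list_of_set (lev e)"
  have finZ: "finite ?Z" using fin lev e by blast
  obtain i where i: "e = {?zs ! i, ?zs ! (i + k)}" "i + k < card ?Z"
    using lev e(1) by (auto simp: skip_edges_def)
  define a b where "a = ?zs ! i" and "b = ?zs ! (i + k)"
  have eab: "e = {a, b}" using i(1) unfolding a_def b_def .
  have ab: "a < b" "a \<in> ?Z" "b \<in> ?Z"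
    using sorted_list_nth_less_iff[OF finZ, of i "i + k"] sorted_list_nth_mem[OF finZ, of i]
      sorted_list_nth_mem[OF finZ, of "i + k"] i(2) k by (auto simp: a_def b_def)
  have "cnt ?Z a b = k"
    using cnt_below[of a b ?Z] card_below_nth[OF finZ, of i] card_below_nth[OF finZ, of "i + k"] i(2) ab
    by (simp add: a_def b_def)
  then have inner: "cnt ?Z (Suc a) b = k - 1" using cnt_Suc_left[of a b ?Z] ab by simp
  have "\<exists>v. v \<in> f \<and> v \<in> ?Z \<inter> {Suc a..<b}" if f: "f \<in> X - {e}" for f
  proof -
    have "f \<subseteq> ?Z" using skip_edges_imp_subset[of "lev f" f k] lev f sub[of f] fin by blast
    moreover have "crosses e f" using X(3) f e(1) unfolding pairwise_def by blast
    then have "crosses {a, b} f" unfolding eab .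
    then obtain v where "v \<in> f" "a < v" "v < b" using crosses_inner_endpoint ab(1) by blast
    ultimately show ?thesis by (auto simp: Suc_le_eq)
  qed
  then obtain v where v: "\<And>f. f \<in> X - {e} \<Longrightarrow> v f \<in> f \<and> v f \<in> ?Z \<inter> {Suc a..<b}" by metis
  have "inj_on v (X - {e})"
  proof (rule inj_onI, rule ccontr)
    fix f g assume fg: "f \<in> X - {e}" "g \<in> X - {e}" "v f = v g" "f \<noteq> g"
    then have "f \<inter> g = {}" using X(3) crosses_disjoint[of f g] unfolding pairwise_def by blast
    then show False using v[OF fg(1)] v[OF fg(2)] fg(3) by auto
  qed
  then have "card (X - {e}) \<le> card (?Z \<inter> {Suc a..<b})"
  proof (rule card_inj_on_le)
    show "v ` (X - {e}) \<subseteq> ?Z \<inter> {Suc a..<b}" using v by blast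
  qed simp
  then show False using inner X(2) e(1) finX k by (simp add: cnt_def)
qed

lemma crossing_free_extend:
  assumes "crossing_free n (k + 1) T0" "T0 \<subseteq> edges n"
  obtains T where "k_triangulation n k T" "T0 \<subseteq> T"
proof -
  let ?A = "{T. T \<subseteq> edges n \<and> crossing_free n (k + 1) T}"
  have "finite ?A" by (rule finite_subset[of _ "Pow (edges n)"]) (auto simp: finite_edges)
  then obtain T where T: "T \<in> ?A" "T0 \<subseteq> T" "\<forall>T'\<in>?A. T \<subseteq> T' \<longrightarrow> T = T'"
    using finite_has_maximal2[of ?A T0] assms by blast
  show thesis
  proof
    show "k_triangulation n k T" unfolding k_triangulation_def using T by blast
  qed fact
qed

lemma skip_edges_subset_edges:
  assumes "0 < k" "Z \<subseteq> {..<n}"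
  shows "skip_edges k Z \<subseteq> edges n"
proof
  fix e assume "e \<in> skip_edges k Z"
  then obtain i where i: "e = {sorted_list_of_set Z ! i, sorted_list_of_set Z ! (i + k)}" "i + k < card Z"
    by (auto simp: skip_edges_def)
  have fin: "finite Z" using assms(2) finite_subset by blast
  let ?u = "sorted_list_of_set Z ! i" and ?v = "sorted_list_of_set Z ! (i + k)"
  have "?u < n" "?v < n" "?u \<noteq> ?v"
    using i sorted_list_nth_less_iff[OF fin, of i "i + k"] sorted_list_nth_mem[OF fin, of i]
      sorted_list_nth_mem[OF fin, of "i + k"] assms by auto
  then show "e \<in> edges n" unfolding edges_def i(1) by blast
qed

lemma chain_triangulation:
  assumes "0 < k" "\<And>Z. Z \<in> A \<Longrightarrow> Z \<subseteq> {..<n}"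
    and "\<And>Z Z'. Z \<in> A \<Longrightarrow> Z' \<in> A \<Longrightarrow> Z \<subseteq> Z' \<or> Z' \<subseteq> Z"
  obtains T where "k_triangulation n k T" "\<And>Z. Z \<in> A \<Longrightarrow> skip_edges k Z \<subseteq> T"
proof -
  have "crossing_free n (k + 1) (\<Union>Z\<in>A. skip_edges k Z)"
    using assms finite_subset[OF _ finite_lessThan] by (intro crossing_free_Union_skip_edges) metis+
  moreover have "(\<Union>Z\<in>A. skip_edges k Z) \<subseteq> edges n" using skip_edges_subset_edges assms(1,2) by blast
  ultimately obtain T where "k_triangulation n k T" "(\<Union>Z\<in>A. skip_edges k Z) \<subseteq> T"
    by (rule crossing_free_extend)
  then show thesis using that by blast
qed

section \<open>Exchanging two coordinates\<close>

context
  fixes n k :: nat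
  assumes k: "0 < k" and n: "2 * k + 1 \<le> n"
begin

lemma bordered_Diff:
  assumes "bordered n k Z" "P \<subseteq> Mid n k"
  shows "bordered n k (Z - P)"
proof -
  have "P \<inter> {..<k} = {}" "P \<inter> {n - k..<n} = {}" using assms(2) by auto
  then show ?thesis using assms(1) unfolding bordered_def by blast
qed

text \<open>Each corner contributes \<open>max 0 (total - zeros)\<close>, a convex function of the
  number of zeros. Strictness needs a corner whose interval contains \<open>p\<close> and
  \<open>q\<close> and where the total is one less than the number of zeros in
  \<open>Mid\<close>.\<close>

lemma least_cost_strict_convex:
  assumes kt: "k_triangulation n k T" and Z: "bordered n k Z"
    and pq: "p < q" "p \<in> Mid n k" "q \<in> Mid n k" "p \<in> Z" "q \<in> Z" and cnt: "cnt Z p (Suc q) \<le> k + 1"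
  shows "least_cost n k T (Z - {p}) + least_cost n k T (Z - {q}) < least_cost n k T Z + least_cost n k T (Z - {p, q})"
proof -
  have "Suc (n - (n - k)) \<le> cnt Z q n"
    using cnt_Suc_left[of q n Z] cnt_ge[of "n - k" n Z "Suc q" n] Z pq by (simp add: bordered_def)
  moreover have "Suc (cnt Z q n) \<le> cnt Z p n"
    using cnt_Suc_left[of p n Z] cnt_mono[of "Suc p" q n n Z] pq by simp
  ultimately have "k + 1 \<le> cnt Z p n" using n by simp
  then have "\<exists>Y. Suc q \<le> Y \<and> Y \<le> n \<and> cnt Z p Y = k + 1"
    using cnt pq cnt_Suc_right[of p _ Z] by (intro nat_intermediate) auto
  \<comment> \<open>The corner \<open>(p, Y)\<close>, with exactly \<open>k + 1\<close> zeros, is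
    the strict one: removing \<open>p\<close> leaves \<open>k\<close> zeros, which determines the
    total there.\<close>
  then obtain Y where Y: "q < Y" "Y \<le> n" "cnt Z p Y = k + 1" by (metis Suc_le_eq)
  obtain T0 where T0: "k_triangulation n k T0" "skip_edges k (Z - {p}) \<subseteq> T0"
  proof (rule chain_triangulation[OF k, of "{Z - {p}}" n])
    show "W \<subseteq> {..<n}" if "W \<in> {Z - {p}}" for W using that Z by (auto simp: bordered_def)
  qed auto
  have Z': "bordered n k (Z - {p})" using Z pq by (intro bordered_Diff) auto
  have "(Z - {p}) \<inter> {p..<Y} = Z \<inter> {p..<Y} - {p}" by auto
  then have "cnt (Z - {p}) p Y = k" using Y pq by (simp add: cnt_def)
  then have tot: "brick_total n k T p Y = card ((Z - {p}) \<inter> Mid n k \<inter> {p..<Y})"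
    using brick_total_skip[OF k n T0(1) Z' T0(2) _ Y(2)] brick_total_indep[OF k n kt T0(1) Y(2)] by simp
  define c where "c X Y = card (Z \<inter> Mid n k \<inter> {X..<Y})" for X Y
  have c: "card ((Z - {p}) \<inter> Mid n k \<inter> {X..<Y}) = c X Y - (if p \<in> {X..<Y} then 1 else 0)"
    "card ((Z - {q}) \<inter> Mid n k \<inter> {X..<Y}) = c X Y - (if q \<in> {X..<Y} then 1 else 0)"
    "card ((Z - {p, q}) \<inter> Mid n k \<inter> {X..<Y}) = c X Y - (if p \<in> {X..<Y} then 1 else 0) - (if q \<in> {X..<Y} then 1 else 0)"
    "(if p \<in> {X..<Y} then 1 else 0) + (if q \<in> {X..<Y} then 1 else 0) \<le> c X Y" for X Y
  proof -
    define A where "A = Z \<inter> Mid n k \<inter> {X..<Y}"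
    have A: "finite A" "p \<in> A \<longleftrightarrow> p \<in> {X..<Y}" "q \<in> A \<longleftrightarrow> q \<in> {X..<Y}" using pq by (auto simp: A_def)
    have eq: "(Z - P) \<inter> Mid n k \<inter> {X..<Y} = A - P" for P by (auto simp: A_def)
    have "A - {p, q} = (A - {p}) - {q}" by auto
    then show "card ((Z - {p}) \<inter> Mid n k \<inter> {X..<Y}) = c X Y - (if p \<in> {X..<Y} then 1 else 0)"
      "card ((Z - {q}) \<inter> Mid n k \<inter> {X..<Y}) = c X Y - (if q \<in> {X..<Y} then 1 else 0)"
      "card ((Z - {p, q}) \<inter> Mid n k \<inter> {X..<Y}) = c X Y - (if p \<in> {X..<Y} then 1 else 0) - (if q \<in> {X..<Y} then 1 else 0)"
      unfolding eq c_def A_def[symmetric] A(2,3)[symmetric] using A(1) pq(1)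
      by (simp_all add: card_Diff_singleton_if)
    have "card ({p, q} \<inter> A) \<le> card A" using A(1) by (intro card_mono) auto
    then show "(if p \<in> {X..<Y} then 1 else 0) + (if q \<in> {X..<Y} then 1 else 0) \<le> c X Y"
      unfolding c_def A_def[symmetric] A(2,3)[symmetric] using pq(1) by (auto split: if_splits)
  qed
  let ?I = "{1..n} \<times> {1..n}"
  define g where "g W = (\<lambda>(X, Y). brick_total n k T X Y - card (W \<inter> Mid n k \<inter> {X..<Y}))" for W
  have lc: "least_cost n k T W = sum (g W) ?I" for W
    by (simp add: least_cost_def[OF k n] g_def)
  have "(\<Sum>b\<in>?I. g (Z - {p}) b + g (Z - {q}) b) < (\<Sum>b\<in>?I. g Z b + g (Z - {p, q}) b)"
  proof (rule sum_strict_mono_ex1)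
    have "g (Z - {p}) (X, Y) + g (Z - {q}) (X, Y) \<le> g Z (X, Y) + g (Z - {p, q}) (X, Y)" for X Y
      using c(4)[of X Y] unfolding g_def prod.case c(1-3) c_def[symmetric] by (auto split: if_splits)
    then show "\<forall>b\<in>?I. g (Z - {p}) b + g (Z - {q}) b \<le> g Z b + g (Z - {p, q}) b" by auto
    have "g (Z - {p}) (p, Y) + g (Z - {q}) (p, Y) < g Z (p, Y) + g (Z - {p, q}) (p, Y)"
      using c(4)[of p Y] tot Y(1) pq(1) unfolding g_def prod.case c(1-3) c_def[symmetric] by auto
    moreover have "(p, Y) \<in> ?I" using pq Y k by auto
    ultimately show "\<exists>b\<in>?I. g (Z - {p}) b + g (Z - {q}) b < g Z b + g (Z - {p, q}) b" by blast
  qed simp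
  then show ?thesis by (simp add: lc sum.distrib)
qed

text \<open>The positions that are still zeros when those in \<open>f\<close>-order before \<open>j\<close> have been turned into ones.\<close>

definition level :: "(nat \<Rightarrow> nat) \<Rightarrow> nat \<Rightarrow> nat set" where
  "level f j = {v. v < n \<and> (v \<in> Mid n k \<longrightarrow> j \<le> f v)}"

text \<open>The levels are nested, so one k-triangulation attains the minimum for all of them.
  Consecutive minima differ by a single coordinate, which is thereby determined.\<close>

lemma removal_order:
  assumes inj: "inj_on f (Mid n k)"
  obtains T where "k_triangulation n k T" "\<And>j. skip_edges k (level f j) \<subseteq> T"
    "\<And>r. r \<in> Mid n k \<Longrightarrow> psi n T r + least_cost n k T (level f (f r)) = least_cost n k T (level f (Suc (f r)))"
proof -
  obtain T where T: "k_triangulation n k T" "\<And>Z. Z \<in> range (level f) \<Longrightarrow> skip_edges k Z \<subseteq> T"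
  proof (rule chain_triangulation[OF k, of "range (level f)" n])
    fix Z Z' assume "Z \<in> range (level f)" "Z' \<in> range (level f)"
    then obtain i j where ij: "Z = level f i" "Z' = level f j" by auto
    show "Z \<subseteq> Z' \<or> Z' \<subseteq> Z" unfolding ij level_def by (cases "i \<le> j") auto
  qed (auto simp: level_def)
  have b: "bordered n k (level f j)" for j
    using n by (auto simp: bordered_def level_def)
  have cost: "(\<Sum>m\<in>Mid n k - level f j. psi n T m) = least_cost n k T (level f j)" for j
    using least_cost_attained[OF k n T(1) b T(2)] by auto
  show thesis
  proof
    show "k_triangulation n k T" by fact
    show "skip_edges k (level f j) \<subseteq> T" for j using T(2) by auto
    fix r assume r: "r \<in> Mid n k"
    have "x \<in> Mid n k - level f (Suc (f r)) \<longleftrightarrow> x \<in> insert r (Mid n k - level f (f r))" for x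
      using inj_onD[OF inj, of x r] r by (auto simp: level_def)
    then have "Mid n k - level f (Suc (f r)) = insert r (Mid n k - level f (f r))" by blast
    moreover have "r \<notin> Mid n k - level f (f r)" using r by (auto simp: level_def)
    ultimately have "(\<Sum>m\<in>Mid n k - level f (Suc (f r)). psi n T m) = psi n T r + (\<Sum>m\<in>Mid n k - level f (f r). psi n T m)"
      by simp
    then show "psi n T r + least_cost n k T (level f (f r)) = least_cost n k T (level f (Suc (f r)))"
      by (simp add: cost)
  qed
qed

text \<open>Two removal orders that differ by swapping \<open>p\<close> and \<open>q\<close> in
  consecutive steps share all levels but the one in between. Only these two coordinates can change,
  their sum is kept, and strict convexity makes the change nonzero.\<close>

lemma exchange_pair:
  assumes Z: "bordered n k Z" and pq: "p < q" "p \<in> Mid n k" "q \<in> Mid n k" "p \<in> Z" "q \<in> Z"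
    and cnt: "cnt Z p (Suc q) \<le> k + 1"
  obtains T T' where "k_triangulation n k T" "k_triangulation n k T'"
    "skip_edges k Z \<subseteq> T" "skip_edges k Z \<subseteq> T'"
    "skip_edges k (Z - {p, q}) \<subseteq> T" "skip_edges k (Z - {p, q}) \<subseteq> T'"
    "\<And>r. r \<in> Mid n k \<Longrightarrow> r \<noteq> p \<Longrightarrow> r \<noteq> q \<Longrightarrow> psi n T r = psi n T' r"
    "psi n T p < psi n T' p" "psi n T p + psi n T q = psi n T' p + psi n T' q"
proof -
  \<comment> \<open>The ones of \<open>Z\<close> come first, with values below \<open>n\<close>;
    then \<open>p\<close> and \<open>q\<close>; then the other zeros. So \<open>Z\<close> is level
    \<open>n\<close> and \<open>Z - {p, q}\<close> is level \<open>n + 2\<close>.\<close>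
  define f where "f p q m = (if m \<notin> Z then m else if m = p then n else if m = q then n + 1 else n + 2 + m)" for p q m :: nat
  have inj: "inj_on (f a b) (Mid n k)" for a b
    by (rule inj_onI) (auto simp: f_def split: if_splits)
  have Zn: "Z \<subseteq> {..<n}" "v < n \<Longrightarrow> v \<notin> Mid n k \<Longrightarrow> v \<in> Z" for v
    using Z by (auto simp: bordered_def)
  have lev: "level (f a b) n = Z" "level (f a b) (Suc n) = Z - {a}" "level (f a b) (Suc (Suc n)) = Z - {a, b}"
    if "a \<in> Mid n k" "b \<in> Mid n k" "a \<in> Z" "b \<in> Z" "a \<noteq> b" for a b
    using that Zn by (auto simp: level_def f_def split: if_splits)
  obtain T where T: "k_triangulation n k T" "\<And>j. skip_edges k (level (f p q) j) \<subseteq> T"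
    "\<And>r. r \<in> Mid n k \<Longrightarrow> psi n T r + least_cost n k T (level (f p q) (f p q r)) = least_cost n k T (level (f p q) (Suc (f p q r)))"
    using removal_order[OF inj] by metis
  obtain T' where T': "k_triangulation n k T'" "\<And>j. skip_edges k (level (f q p) j) \<subseteq> T'"
    "\<And>r. r \<in> Mid n k \<Longrightarrow> psi n T' r + least_cost n k T' (level (f q p) (f q p r)) = least_cost n k T' (level (f q p) (Suc (f q p r)))"
    using removal_order[OF inj] by metis
  note indep = least_cost_indep[OF k n T'(1) T(1)]
  note l = lev[of p q] lev[of q p]
  have fv: "f a b a = n" "f a b b = Suc n" if "a \<in> Z" "b \<in> Z" "a \<noteq> b" for a b
    using that by (auto simp: f_def)
  have comm: "Z - {q, p} = Z - {p, q}" by auto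
  have vals: "psi n T p + least_cost n k T Z = least_cost n k T (Z - {p})"
    "psi n T q + least_cost n k T (Z - {p}) = least_cost n k T (Z - {p, q})"
    "psi n T' q + least_cost n k T Z = least_cost n k T (Z - {q})"
    "psi n T' p + least_cost n k T (Z - {q}) = least_cost n k T (Z - {p, q})"
    using T(3)[of p] T(3)[of q] T'(3)[of p] T'(3)[of q] l fv[of p q] fv[of q p] pq
    by (simp_all add: indep comm)
  show thesis
  proof
    show "k_triangulation n k T" "k_triangulation n k T'" by fact+
    show "skip_edges k Z \<subseteq> T" "skip_edges k Z \<subseteq> T'"
      "skip_edges k (Z - {p, q}) \<subseteq> T" "skip_edges k (Z - {p, q}) \<subseteq> T'"
      using T(2)[of n] T'(2)[of n] T(2)[of "Suc (Suc n)"] T'(2)[of "Suc (Suc n)"] l pq by (simp_all add: comm)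
    show "psi n T p < psi n T' p" "psi n T p + psi n T q = psi n T' p + psi n T' q"
      using vals least_cost_strict_convex[OF T(1) Z pq cnt] by linarith+
    fix r assume r: "r \<in> Mid n k" "r \<noteq> p" "r \<noteq> q"
    have same: "level (f p q) j = level (f q p) j" if "j \<le> n \<or> Suc (Suc n) \<le> j" for j
    proof -
      have "j \<le> f p q v \<longleftrightarrow> j \<le> f q p v" for v
        using that unfolding f_def by (cases "v = p"; cases "v = q") auto
      then show ?thesis by (simp add: level_def)
    qed
    have "f p q r = f q p r" "f p q r < n \<or> Suc (Suc n) \<le> f p q r"
      using r by (auto simp: f_def)
    then show "psi n T r = psi n T' r"
      using T(3)[OF r(1)] T'(3)[OF r(1)] same[of "f p q r"] same[of "Suc (f p q r)"]
      by (auto simp: indep)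
  qed
qed

text \<open>Summing the fixed brick totals over all corners puts all beam vectors on one
  hyperplane.\<close>

lemma sum_psi_Mid_indep:
  assumes "k_triangulation n k T" "k_triangulation n k T'"
  shows "(\<Sum>m\<in>Mid n k. psi n T m) = (\<Sum>m\<in>Mid n k. psi n T' m)"
proof -
  have "(\<Sum>m\<in>Mid n k. psi n S m) = (\<Sum>(X, Y)\<in>{1..n} \<times> {1..n}. brick_total n k S X Y)" for S
    unfolding brick_total_def[OF k n] by (rule sum_psi[OF k n]) simp
  then show ?thesis using brick_total_indep[OF k n assms] by (auto intro!: sum.cong)
qed

end

lemma constant_on_of_consecutive:
  fixes g :: "nat \<Rightarrow> 'a"
  assumes "\<And>p q. p \<in> S \<Longrightarrow> q \<in> S \<Longrightarrow> p < q \<Longrightarrow> (\<forall>r\<in>S. \<not> (p < r \<and> r < q)) \<Longrightarrow> g p = g q"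
    and "p \<in> S" "q \<in> S"
  shows "g p = g q"
proof -
  have *: "g p = g q" if "p \<in> S" "q \<in> S" "p < q" for p q
    using that
  proof (induction "q - p" arbitrary: p q rule: less_induct)
    case less
    show ?case
    proof (cases "\<exists>r\<in>S. p < r \<and> r < q")
      case True
      then obtain r where r: "r \<in> S" "p < r" "r < q" by blast
      then have "r - p < q - p" "q - r < q - p" by auto
      then show ?thesis using less(1)[of r p] less(1)[of q r] less(2,3) r by metis
    next
      case False
      then show ?thesis using assms(1) less by blast
    qed
  qed
  show ?thesis using *[of p q] *[of q p] assms(2,3) by (metis linorder_neqE_nat)
qed

section \<open>Zero positions of a valid sequence\<close>

definition zeros :: "nat \<Rightarrow> nat \<Rightarrow> nat list \<Rightarrow> nat set" where
  "zeros n k \<sigma> = {p. p < n \<and> (p < k \<or> n - k \<le> p \<or> \<sigma> ! (p - k) = 0)}"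

lemma bordered_zeros: "2 * k + 1 \<le> n \<Longrightarrow> bordered n k (zeros n k \<sigma>)"
  by (auto simp: bordered_def zeros_def)

lemma D_edges_eq_skip_edges:
  assumes n: "2 * k + 1 \<le> n" and len: "length \<sigma> = n - 2 * k"
  shows "D_edges k \<sigma> = skip_edges k (zeros n k \<sigma>)"
proof -
  define w where "w = replicate k 0 @ \<sigma> @ replicate k (0::nat)"
  have lw: "length w = n" using n len by (simp add: w_def)
  have wp: "w ! p = 0 \<longleftrightarrow> p < k \<or> n - k \<le> p \<or> \<sigma> ! (p - k) = 0" if "p < n" for p
    using that n len by (auto simp: w_def nth_append)
  let ?zs = "filter (\<lambda>p. w ! p = 0) [0..<n]"
  have "set ?zs = zeros n k \<sigma>" using wp by (auto simp: zeros_def)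
  moreover have "sorted ?zs" "distinct ?zs" by (auto intro: sorted_filter[of "\<lambda>x. x", simplified])
  ultimately have zs: "sorted_list_of_set (zeros n k \<sigma>) = ?zs"
    by (metis sorted_list_of_set.idem_if_sorted_distinct)
  have "zeros n k \<sigma> = {i. i < length w \<and> 0 = w ! i}" using wp lw by (auto simp: zeros_def)
  then have "card (zeros n k \<sigma>) = length (filter ((=) 0) w)"
    by (simp add: length_filter_conv_card)
  then have card: "card (zeros n k \<sigma>) = count_list \<sigma> 0 + 2 * k"
    by (simp add: w_def count_list_eq_length_filter)
  have zp: "zero_pos k \<sigma> i = ?zs ! (i - 1)" for i
    by (simp add: zero_pos_def Let_def w_def[symmetric] lw del: upt_Suc)
  show ?thesis
  proof
    show "D_edges k \<sigma> \<subseteq> skip_edges k (zeros n k \<sigma>)"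
    proof
      fix e assume "e \<in> D_edges k \<sigma>"
      then obtain i where "e = {?zs ! (i - 1), ?zs ! (i + k - 1)}" "1 \<le> i" "i \<le> count_list \<sigma> 0 + k"
        unfolding D_edges_def zp by auto
      then show "e \<in> skip_edges k (zeros n k \<sigma>)"
        unfolding skip_edges_def zs card by (intro CollectI exI[of _ "i - 1"]) auto
    qed
    show "skip_edges k (zeros n k \<sigma>) \<subseteq> D_edges k \<sigma>"
    proof
      fix e assume "e \<in> skip_edges k (zeros n k \<sigma>)"
      then obtain i where "e = {?zs ! i, ?zs ! (i + k)}" "i + k < count_list \<sigma> 0 + 2 * k"
        unfolding skip_edges_def zs card by auto
      then show "e \<in> D_edges k \<sigma>"
        unfolding D_edges_def zp by (intro CollectI exI[of _ "Suc i"]) auto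
    qed
  qed
qed

text \<open>Only zeros lie between consecutive ones; a larger distance would give a forbidden block
  \<open>1 0\<^sup>r 1\<close> with \<open>r = q - p - 1\<close>.\<close>

lemma k_valid_consecutive_ones:
  assumes n: "2 * k + 1 \<le> n" and v: "k_valid k (n - 2 * k) \<sigma>"
    and pq: "p < q" "p \<in> Mid n k - zeros n k \<sigma>" "q \<in> Mid n k - zeros n k \<sigma>"
    and none: "\<forall>r\<in>Mid n k - zeros n k \<sigma>. \<not> (p < r \<and> r < q)"
  shows "q - p \<le> k"
proof (rule ccontr)
  assume "\<not> ?thesis"
  then have r: "k \<le> q - p - 1" by simp
  have len: "length \<sigma> = n - 2 * k" and bin: "set \<sigma> \<subseteq> {0, 1}" using v by (auto simp: k_valid_def)
  have val: "\<sigma> ! (v - k) = (if v \<in> zeros n k \<sigma> then 0 else 1)" if "v \<in> Mid n k" for v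
  proof -
    have "v - k < length \<sigma>" using that len by auto
    then have "\<sigma> ! (v - k) \<in> {0, 1}" using bin nth_mem by blast
    then show ?thesis using that n by (auto simp: zeros_def)
  qed
  let ?b = "[1] @ replicate (q - p - 1) 0 @ [1::nat]"
  have "take (q - p + 1) (drop (p - k) \<sigma>) = ?b"
  proof (rule nth_equalityI)
    show l: "length (take (q - p + 1) (drop (p - k) \<sigma>)) = length ?b" using len pq n by auto
    fix i assume "i < length (take (q - p + 1) (drop (p - k) \<sigma>))"
    then have i: "i < q - p + 1" by simp
    then have m: "p + i \<in> Mid n k" using pq by auto
    have "take (q - p + 1) (drop (p - k) \<sigma>) ! i = \<sigma> ! ((p + i) - k)"
    proof -
      have "p - k \<le> length \<sigma>" "p - k + i = p + i - k" using len pq by auto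
      then show ?thesis using i by simp
    qed
    also have "\<dots> = ?b ! i"
    proof (cases "i = 0 \<or> i = q - p")
      case True
      then have "p + i \<notin> zeros n k \<sigma>" using pq by auto
      then have "\<sigma> ! (p + i - k) = 1" using val[OF m] by simp
      moreover have "?b ! i = 1" using True pq(1) by (auto simp: nth_append)
      ultimately show ?thesis by simp
    next
      case False
      then have "p < p + i" "p + i < q" using i by auto
      then have "p + i \<in> zeros n k \<sigma>" using none m by blast
      then have "\<sigma> ! (p + i - k) = 0" using val[OF m] by simp
      moreover have "?b ! i = 0" using False i by (auto simp: nth_append nth_Cons')
      ultimately show ?thesis by simp
    qed
    finally show "take (q - p + 1) (drop (p - k) \<sigma>) ! i = ?b ! i" .
  qed
  then have "sublist ?b \<sigma>"
    using sublist_order.order_trans[OF sublist_take sublist_drop] by metis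
  then show False using v r by (auto simp: k_valid_def)
qed

text \<open>A nonconstant sequence has two adjacent different entries; this will show that the
  functional is not constant on the polytope.\<close>

lemma k_valid_change:
  assumes n: "2 * k + 1 \<le> n" and v: "k_valid k (n - 2 * k) \<sigma>"
  obtains p where "p \<in> Mid n k" "Suc p \<in> Mid n k" "(p \<in> zeros n k \<sigma>) \<noteq> (Suc p \<in> zeros n k \<sigma>)"
proof -
  have len: "length \<sigma> = n - 2 * k" and bin: "set \<sigma> \<subseteq> {0, 1}"
    and ne: "\<sigma> \<noteq> replicate (n - 2 * k) 0" "\<sigma> \<noteq> replicate (n - 2 * k) 1" using v by (auto simp: k_valid_def)
  have "\<exists>i. Suc i < length \<sigma> \<and> (\<sigma> ! i = 0) \<noteq> (\<sigma> ! Suc i = 0)"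
  proof (rule ccontr)
    assume "\<not> ?thesis"
    then have st: "(\<sigma> ! Suc i = 0) = (\<sigma> ! i = 0)" if "Suc i < length \<sigma>" for i using that by blast
    have eq: "(\<sigma> ! i = 0) = (\<sigma> ! 0 = 0)" if "i < length \<sigma>" for i
      using that by (induction i) (use st in auto)
    have bin': "\<sigma> ! i = 0 \<or> \<sigma> ! i = 1" if "i < length \<sigma>" for i
      using bin nth_mem[OF that] by auto
    show False
    proof (cases "\<sigma> ! 0 = 0")
      case True
      then have "\<sigma> ! i = 0" if "i < length \<sigma>" for i using eq[OF that] by simp
      then have "\<sigma> = replicate (n - 2 * k) 0" using len by (intro nth_equalityI) auto
      then show False using ne by simp
    next
      case False
      then have "\<sigma> ! i = 1" if "i < length \<sigma>" for i using eq[OF that] bin'[OF that] by simp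
      then have "\<sigma> = replicate (n - 2 * k) 1" using len by (intro nth_equalityI) auto
      then show False using ne by simp
    qed
  qed
  then obtain i where i: "Suc i < n - 2 * k" "(\<sigma> ! i = 0) \<noteq> (\<sigma> ! Suc i = 0)" using len by auto
  show thesis
  proof (rule that[of "k + i"])
    show "k + i \<in> Mid n k" "Suc (k + i) \<in> Mid n k" using i n by auto
    show "(k + i \<in> zeros n k \<sigma>) \<noteq> (Suc (k + i) \<in> zeros n k \<sigma>)" using i n by (auto simp: zeros_def)
  qed
qed

section \<open>The facet\<close>

definition vertex_no :: "nat \<Rightarrow> 'd::{finite,linorder} \<Rightarrow> nat" where
  "vertex_no k a = k + (coord_no a - 1)"

lemma coord_no_bij: "bij_betw (coord_no :: 'd::{finite,linorder} \<Rightarrow> nat) UNIV {1..CARD('d)}"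
proof -
  have mono: "coord_no a < coord_no b" if "a < b" for a b :: 'd
    unfolding coord_no_def by (rule psubset_card_mono) (use that in auto)
  then have inj: "inj (coord_no :: 'd \<Rightarrow> nat)"
    by (metis (no_types, lifting) injI less_irrefl linorder_neqE)
  have "coord_no a \<in> {1..CARD('d)}" for a :: 'd
  proof -
    have "0 < card {..a}" by (simp add: card_gt_0_iff)
    moreover have "card {..a} \<le> CARD('d)" by (rule card_mono) auto
    ultimately show ?thesis by (simp add: coord_no_def)
  qed
  then have "range (coord_no :: 'd \<Rightarrow> nat) \<subseteq> {1..CARD('d)}" by auto
  moreover have "card (range (coord_no :: 'd \<Rightarrow> nat)) = card {1..CARD('d)}" using inj by (simp add: card_image)
  ultimately show ?thesis using inj by (simp add: bij_betw_def card_subset_eq)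
qed

lemma vertex_no_bij:
  assumes "2 * k + 1 \<le> n" "CARD('d::{finite,linorder}) = n - 2 * k"
  shows "bij_betw (vertex_no k :: 'd \<Rightarrow> nat) UNIV (Mid n k)"
proof -
  have "bij_betw (\<lambda>i. k + (i - 1)) {1..CARD('d)} (Mid n k)"
    by (rule bij_betwI[of _ _ _ "\<lambda>m. m - k + 1"]) (use assms in auto)
  from bij_betw_trans[OF coord_no_bij this] show ?thesis by (simp add: vertex_no_def[abs_def] comp_def)
qed

context
  fixes n k :: nat and d :: "'d::{finite,linorder} itself"
  assumes k: "0 < k" and n: "2 * k + 1 \<le> n" and d: "CARD('d) = n - 2 * k"
begin

lemma inner_beam_vector:
  assumes kt: "k_triangulation n k T" and g: "\<And>a :: 'd. y $ a = g (vertex_no k a)"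
  shows "y \<bullet> (beam_vector n k T :: (real, 'd) vec) = (\<Sum>m\<in>Mid n k. g m * real (psi n T m))"
proof -
  have "beam_vector n k T $ a = real (psi n T (vertex_no k a))" for a :: 'd
  proof -
    have "coord_no a \<in> {1..CARD('d)}" using coord_no_bij[where 'd = 'd] by (auto simp: bij_betw_def)
    then have "Suc (vertex_no k a) - k = coord_no a" by (simp add: vertex_no_def)
    moreover have "vertex_no k a \<in> Mid n k" using vertex_no_bij[OF n d] by (auto simp: bij_betw_def)
    ultimately show ?thesis using psi_eq_beam_coord[OF k n kt] by (metis (no_types) beam_vector_def vec_lambda_beta)
  qed
  then have "y \<bullet> (beam_vector n k T :: (real, 'd) vec) = (\<Sum>a\<in>UNIV. g (vertex_no k (a :: 'd)) * real (psi n T (vertex_no k a)))"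
    by (simp add: inner_vec_def g)
  also have "\<dots> = (\<Sum>m\<in>Mid n k. g m * real (psi n T m))"
    by (rule sum.reindex_bij_betw[OF vertex_no_bij[OF n d]])
  finally show ?thesis .
qed

text \<open>The two beam vectors differ by a multiple of the difference of two unit vectors.\<close>

lemma inner_beam_vector_diff:
  assumes kt: "k_triangulation n k T" "k_triangulation n k T'" and g: "\<And>a :: 'd. y $ a = g (vertex_no k a)"
    and pq: "p \<noteq> q" "p \<in> Mid n k" "q \<in> Mid n k"
    and eq: "\<And>r. r \<in> Mid n k \<Longrightarrow> r \<noteq> p \<Longrightarrow> r \<noteq> q \<Longrightarrow> psi n T r = psi n T' r"
    and s: "psi n T p + psi n T q = psi n T' p + psi n T' q"
  shows "y \<bullet> (beam_vector n k T :: (real, 'd) vec) - y \<bullet> beam_vector n k T' = (g p - g q) * (real (psi n T p) - real (psi n T' p))"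
proof -
  have "y \<bullet> (beam_vector n k T :: (real, 'd) vec) - y \<bullet> beam_vector n k T'
      = (\<Sum>m\<in>Mid n k. g m * (real (psi n T m) - real (psi n T' m)))"
    using inner_beam_vector[OF kt(1), of y g] inner_beam_vector[OF kt(2), of y g] g
    by (simp add: sum_subtractf right_diff_distrib)
  also have "\<dots> = (\<Sum>m\<in>{p, q}. g m * (real (psi n T m) - real (psi n T' m)))"
    using pq eq by (intro sum.mono_neutral_right) auto
  also have "\<dots> = g p * (real (psi n T p) - real (psi n T' p)) + g q * (real (psi n T q) - real (psi n T' q))"
    using pq by simp
  also have "real (psi n T q) - real (psi n T' q) = - (real (psi n T p) - real (psi n T' p))"
    using s by linarith
  finally show ?thesis by (simp add: algebra_simps)
qed

end

theorem theorem1p3p18: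
  fixes n k :: nat and \<sigma> :: "nat list" and F :: "(real ^ 'd::{finite,linorder}) set"
  assumes "k \<ge> 1" and "n \<ge> 2 * k + 1" and "CARD('d) = n - 2 * k"
    and "k_valid k (n - 2 * k) \<sigma>"
    and "F = minimizers (seq_vector \<sigma>) (beam_polytope n k)"
  shows "F facet_of beam_polytope n k \<and>
    (\<forall>T. k_triangulation n k T \<longrightarrow> (beam_vector n k T \<in> F \<longleftrightarrow> D_edges k \<sigma> \<subseteq> T))"
proof -
  note n = assms(2) and d = assms(3) and valid = assms(4)
  have k: "0 < k" using assms(1) by simp
  define Z where "Z = zeros n k \<sigma>"
  define P :: "((real, 'd) vec) set" where "P = beam_polytope n k"
  define c :: "(real, 'd) vec" where "c = seq_vector \<sigma>"
  have Z: "bordered n k Z" unfolding Z_def by (rule bordered_zeros[OF n])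
  have len: "length \<sigma> = n - 2 * k" and bin: "set \<sigma> \<subseteq> {0, 1}" using valid by (auto simp: k_valid_def)
  have D: "D_edges k \<sigma> = skip_edges k Z" unfolding Z_def by (rule D_edges_eq_skip_edges[OF n len])
  note bij = vertex_no_bij[OF n d]
  have mid: "vertex_no k a \<in> Mid n k" for a :: 'd using bij by (auto simp: bij_betw_def)
  have c_eq: "c $ a = (if vertex_no k a \<in> Z then 0 else 1)" for a
  proof -
    have i: "coord_no a - 1 < length \<sigma>" using mid[of a] n len by (auto simp: vertex_no_def)
    then have "\<sigma> ! (coord_no a - 1) \<in> {0, 1}" using bin nth_mem by blast
    then show ?thesis using mid[of a] n by (auto simp: c_def seq_vector_def Z_def zeros_def vertex_no_def)
  qed
  obtain T0 where T0: "k_triangulation n k T0" "skip_edges k Z \<subseteq> T0"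
  proof (rule chain_triangulation[OF k, of "{Z}" n])
    show "W \<subseteq> {..<n}" if "W \<in> {Z}" for W using that Z by (auto simp: bordered_def)
  qed auto
  define M where "M = real (least_cost n k T0 Z)"
  have cost: "c \<bullet> (beam_vector n k T :: (real, 'd) vec) = real (\<Sum>m\<in>Mid n k - Z. psi n T m)"
    if T: "k_triangulation n k T" for T
  proof -
    have "c \<bullet> (beam_vector n k T :: (real, 'd) vec) = (\<Sum>m\<in>Mid n k. (if m \<in> Z then 0 else 1) * real (psi n T m))"
      by (rule inner_beam_vector[OF k n d T]) (rule c_eq)
    also have "\<dots> = (\<Sum>m\<in>Mid n k - Z. real (psi n T m))"
      by (intro sum.mono_neutral_cong_right) auto
    finally show ?thesis by simp
  qed
  have lc: "real (least_cost n k T Z) = M" if "k_triangulation n k T" for T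
    using least_cost_indep[OF k n that T0(1)] by (simp add: M_def)
  have ge: "M \<le> c \<bullet> (beam_vector n k T :: (real, 'd) vec)" if "k_triangulation n k T" for T
    unfolding cost[OF that] lc[OF that, symmetric] of_nat_le_iff by (rule least_cost_le[OF k n])
  have eq_iff: "c \<bullet> (beam_vector n k T :: (real, 'd) vec) = M \<longleftrightarrow> skip_edges k Z \<subseteq> T" if T: "k_triangulation n k T" for T
    unfolding cost[OF T] lc[OF T, symmetric] of_nat_eq_iff
    using least_cost_attained[OF k n T Z] skip_edges_subset_of_attained[OF k n T T0(1) Z T0(2)] by blast
  let ?V = "beam_vector n k ` {T. k_triangulation n k T} :: ((real, 'd) vec) set"
  have P: "P = convex hull ?V" by (simp add: P_def beam_polytope_def)
  have inP: "beam_vector n k T \<in> P" if "k_triangulation n k T" for T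
    unfolding P using that by (intro hull_inc) auto
  have "P \<subseteq> {x. M \<le> c \<bullet> x}"
    unfolding P by (rule hull_minimal) (use ge convex_halfspace_ge in auto)
  then have P_ge: "M \<le> c \<bullet> x" if "x \<in> P" for x using that by auto
  have T0_eq: "c \<bullet> (beam_vector n k T0 :: (real, 'd) vec) = M" using eq_iff T0 by simp
  have F: "F = P \<inter> {x. c \<bullet> x = M}"
  proof -
    have "F = {x \<in> P. \<forall>y\<in>P. c \<bullet> x \<le> c \<bullet> y}" using assms(5) by (simp add: minimizers_def P_def c_def)
    also have "\<dots> = P \<inter> {x. c \<bullet> x = M}"
      using P_ge inP[OF T0(1)] T0_eq by (auto intro: antisym)
    finally show ?thesis .
  qed
  have mem_F: "beam_vector n k T \<in> F \<longleftrightarrow> skip_edges k Z \<subseteq> T" if "k_triangulation n k T" for T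
    using eq_iff[OF that] inP[OF that] by (simp add: F)
  have face: "F face_of P" unfolding F
    by (rule face_of_Int_supporting_hyperplane_ge) (use P_ge P in auto)
  have neq: "F \<noteq> P"
  proof
    assume FP: "F = P"
    obtain p where p: "p \<in> Mid n k" "Suc p \<in> Mid n k" "(p \<in> Z) \<noteq> (Suc p \<in> Z)"
      unfolding Z_def using k_valid_change[OF n valid] by metis
    \<comment> \<open>Making both positions zeros allows an exchange of \<open>p\<close> and
      \<open>Suc p\<close>. It changes the functional, whose coefficients there are 0 and 1 in some
      order.\<close>
    define Z' where "Z' = Z \<union> {p, Suc p}"
    have Z': "bordered n k Z'" "p \<in> Z'" "Suc p \<in> Z'" using Z p by (auto simp: Z'_def bordered_def)
    have "cnt Z' p (Suc (Suc p)) \<le> k + 1"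
      using card_mono[of "{p..<Suc (Suc p)}" "Z' \<inter> {p..<Suc (Suc p)}"] k by (simp add: cnt_def)
    from exchange_pair[OF k n Z'(1) _ p(1,2) Z'(2,3) this] obtain T T' where
      T: "k_triangulation n k T" "k_triangulation n k T'"
      "\<And>r. r \<in> Mid n k \<Longrightarrow> r \<noteq> p \<Longrightarrow> r \<noteq> Suc p \<Longrightarrow> psi n T r = psi n T' r"
      "psi n T p < psi n T' p" "psi n T p + psi n T (Suc p) = psi n T' p + psi n T' (Suc p)"
      by (metis lessI)
    have "c \<bullet> (beam_vector n k T :: (real, 'd) vec) - c \<bullet> beam_vector n k T' = 0"
    proof -
      have "c \<bullet> x = M" if "x \<in> P" for x using that FP F by blast
      then show ?thesis using inP[OF T(1)] inP[OF T(2)] by simp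
    qed
    then have "((if p \<in> Z then 0::real else 1) - (if Suc p \<in> Z then 0 else 1)) * (real (psi n T p) - real (psi n T' p)) = 0"
      using inner_beam_vector_diff[OF k n d T(1,2) c_eq _ p(1,2) T(3,5)] by simp
    then show False using p(3) T(4) by (auto split: if_splits)
  qed
  have P_dim: "aff_dim P \<le> int CARD('d) - 1"
  proof -
    let ?one = "(\<chi> a. 1) :: (real, 'd) vec"
    define C where "C = real (\<Sum>m\<in>Mid n k. psi n T0 m)"
    have "?one \<bullet> beam_vector n k T = C" if "k_triangulation n k T" for T
      using inner_beam_vector[OF k n d that, of ?one "\<lambda>_. 1"] sum_psi_Mid_indep[OF k n that T0(1)]
      by (simp add: C_def flip: of_nat_sum)
    then have "P \<subseteq> {x. ?one \<bullet> x = C}"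
      unfolding P by (intro hull_minimal convex_hyperplane) auto
    then have "aff_dim P \<le> aff_dim {x. ?one \<bullet> x = C}" by (rule aff_dim_subset)
    also have "\<dots> = int CARD('d) - 1" by (subst aff_dim_hyperplane) (auto simp: vec_eq_iff)
    finally show ?thesis .
  qed
  have F_dim: "int CARD('d) - 2 \<le> aff_dim F"
  proof -
    define x0 :: "(real, 'd) vec" where "x0 = beam_vector n k T0"
    have x0: "x0 \<in> F" using mem_F T0 by (simp add: x0_def)
    define A where "A = span ((\<lambda>x. - x0 + x) ` F)"
    have dimA: "aff_dim F = int (dim A)"
      using aff_dim_eq_dim[of x0 F] x0 by (simp add: A_def hull_inc)
    \<comment> \<open>\<open>A\<close> is the direction space of \<open>F\<close>. Bounding its
      orthogonal complement by the span of the indicator vectors of zeros and of ones gives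
      codimension at most 2.\<close>
    define N where "N = {y. \<forall>x\<in>A. orthogonal x y}"
    define u v :: "(real, 'd) vec" where "u = (\<chi> a. if vertex_no k a \<in> Z then 1 else 0)" and "v = c"
    have "N \<subseteq> span {u, v}"
    proof
      fix y assume "y \<in> N"
      then have orth: "y \<bullet> (x - x0) = 0" if "x \<in> F" for x
        using that span_base[of "- x0 + x" "(\<lambda>x. - x0 + x) ` F"]
        by (auto simp: N_def A_def orthogonal_def inner_commute)
      then have same: "y \<bullet> x - y \<bullet> x' = 0" if "x \<in> F" "x' \<in> F" for x x'
        using orth[OF that(1)] orth[OF that(2)] by (simp add: inner_diff_right)
      define g where "g m = y $ (inv (vertex_no k) m)" for m
      have g: "y $ a = g (vertex_no k a)" for a
        using bij by (simp add: g_def bij_betw_def inv_f_f)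
      have step: "g p = g q" if W: "bordered n k W" and pq: "p < q" "p \<in> Mid n k" "q \<in> Mid n k" "p \<in> W" "q \<in> W"
        and cnt: "cnt W p (Suc q) \<le> k + 1" and "W = Z \<or> W - {p, q} = Z" for W p q
      proof -
        from exchange_pair[OF k n W pq cnt] obtain T T' where
          T: "k_triangulation n k T" "k_triangulation n k T'"
          "skip_edges k W \<subseteq> T" "skip_edges k W \<subseteq> T'"
          "skip_edges k (W - {p, q}) \<subseteq> T" "skip_edges k (W - {p, q}) \<subseteq> T'"
          "\<And>r. r \<in> Mid n k \<Longrightarrow> r \<noteq> p \<Longrightarrow> r \<noteq> q \<Longrightarrow> psi n T r = psi n T' r"
          "psi n T p < psi n T' p" "psi n T p + psi n T q = psi n T' p + psi n T' q" by metis
        \<comment> \<open>Both k-triangulations contain \<open>skip_edges\<close> of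
          \<open>W\<close> and of \<open>W - {p, q}\<close>, one of which is \<open>Z\<close>; so
          the exchange stays inside the facet.\<close>
        have "beam_vector n k T \<in> F" "beam_vector n k T' \<in> F" using mem_F T(1-6) that(8) by auto
        then have "(g p - g q) * (real (psi n T p) - real (psi n T' p)) = 0"
          using inner_beam_vector_diff[OF k n d T(1,2) g _ pq(2,3) T(7,9)] same pq(1) by simp
        then show ?thesis using T(8) by simp
      qed
      have zero: "g p = g q" if "p \<in> Mid n k \<inter> Z" "q \<in> Mid n k \<inter> Z" for p q
        using that(1,2)
      proof (rule constant_on_of_consecutive[rotated])
        fix p q assume pq: "p \<in> Mid n k \<inter> Z" "q \<in> Mid n k \<inter> Z" "p < q" "\<forall>r\<in>Mid n k \<inter> Z. \<not> (p < r \<and> r < q)"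
        have "Z \<inter> {p..<Suc q} \<subseteq> {p, q}"
        proof
          fix r assume r: "r \<in> Z \<inter> {p..<Suc q}"
          then have "r \<in> Mid n k \<inter> Z" using pq by auto
          then have "\<not> (p < r \<and> r < q)" using pq(4) by blast
          then show "r \<in> {p, q}" using r by auto
        qed
        then have "card (Z \<inter> {p..<Suc q}) \<le> card {p, q}" by (intro card_mono) auto
        then have "cnt Z p (Suc q) \<le> k + 1" using pq(3) k by (simp add: cnt_def)
        then show "g p = g q" using step[OF Z] pq by blast
      qed
      have one: "g p = g q" if "p \<in> Mid n k - Z" "q \<in> Mid n k - Z" for p q
        using that(1,2)
      proof (rule constant_on_of_consecutive[rotated])
        fix p q assume pq: "p \<in> Mid n k - Z" "q \<in> Mid n k - Z" "p < q" "\<forall>r\<in>Mid n k - Z. \<not> (p < r \<and> r < q)"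
        \<comment> \<open>Validity enters here: the interval from \<open>p\<close> to
          \<open>q\<close> has at most \<open>k + 1\<close> positions, so \<open>p\<close> and
          \<open>q\<close> can be exchanged after adding both to \<open>Z\<close>.\<close>
        have "q - p \<le> k" by (rule k_valid_consecutive_ones[OF n valid pq(3)]) (use pq in \<open>auto simp: Z_def\<close>)
        moreover have "card ((Z \<union> {p, q}) \<inter> {p..<Suc q}) \<le> card {p..<Suc q}" by (intro card_mono) auto
        ultimately have "cnt (Z \<union> {p, q}) p (Suc q) \<le> k + 1" by (simp add: cnt_def)
        moreover have "bordered n k (Z \<union> {p, q})" using Z pq by (auto simp: bordered_def)
        moreover have "Z \<union> {p, q} - {p, q} = Z" using pq by auto
        ultimately show "g p = g q" using step[of "Z \<union> {p, q}" p q] pq by blast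
      qed
      define z w where "z = g (SOME m. m \<in> Mid n k \<inter> Z)" and "w = g (SOME m. m \<in> Mid n k - Z)"
      have z: "g m = z" if "m \<in> Mid n k \<inter> Z" for m
        unfolding z_def by (rule zero[OF that]) (rule someI[of "\<lambda>m. m \<in> Mid n k \<inter> Z", OF that])
      have w: "g m = w" if "m \<in> Mid n k - Z" for m
        unfolding w_def by (rule one[OF that]) (rule someI[of "\<lambda>m. m \<in> Mid n k - Z", OF that])
      have "y = z *\<^sub>R u + w *\<^sub>R v"
        using z w mid by (auto simp: vec_eq_iff u_def v_def c_eq g)
      then show "y \<in> span {u, v}" by (simp add: span_add span_base span_scale)
    qed
    then have "dim N \<le> card {u, v}" by (intro dim_le_card) auto
    also have "\<dots> \<le> 2" by (simp add: card_insert_if)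
    finally have "dim N \<le> 2" .
    moreover have "dim N + dim A = CARD('d)"
      using dim_subspace_orthogonal_to_vectors[of A UNIV] by (simp add: A_def N_def)
    ultimately show ?thesis using dimA by linarith
  qed
  have "aff_dim F < aff_dim P" by (rule face_of_aff_dim_lt[OF _ face neq]) (simp add: P)
  \<comment> \<open>A proper face has smaller dimension, so the two bounds leave only
    \<open>CARD('d) - 2\<close> for \<open>F\<close> and \<open>CARD('d) - 1\<close> for
    \<open>P\<close>.\<close>
  then have "aff_dim F = aff_dim P - 1" using P_dim F_dim by linarith
  moreover have "F \<noteq> {}" using mem_F[OF T0(1)] T0(2) by blast
  ultimately have "F facet_of P" using face by (simp add: facet_of_def)
  then show ?thesis using mem_F by (simp add: P_def D)
qed

end
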